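(* Let $n\ge1$ and $\Theta\subseteq\mathsf{FORM}_n$. Suppose $\mathsf{LIND}(\Theta)$ is semisimple and $\mathrm{Mod}(\Theta)$ has some Bouligand–Severi outgoing rational tangent vector $u$ at some rational point $v\in\mathrm{Mod}(\Theta)$. Then $\mathsf{LIND}(\Theta)$ is not strongly semisimple, and there are formulas $\gamma,\lambda\in\mathsf{FORM}_n$ such that $\Theta\cup\{\gamma\}\models\lambda$ but not $\Theta\cup\{\gamma\}\models_\partial\lambda$. Specifically, every $\psi\in\mathsf{FORM}_n$ with $\Theta\cup\{\gamma\}\models_\partial\psi$ satisfies $\hat\psi(v)=1$ and $\partial\hat\psi(v)/\partial u=0$, while $\hat\lambda(v)=1$ and $\partial\hat\lambda(v)/\partial u<0$.
   Context: $\mathsf{FORM}_n$ is the set of formulas of infinite-valued Łukasiewicz propositional logic in $X_1,\dots,X_n$; $\vdash$ is derivability (Łukasiewicz axioms, Modus Ponens). $\mathsf{LIND}(\Theta)$ is $\mathsf{FORM}_n$ modulo $\phi\equiv_\Theta\psi$ iff $\Theta\vdash\phi\leftrightarrow\psi$, an MV-algebra. An MV-algebra is semisimple if the intersection of its maximal ideals is $\{0\}$, strongly semisimple if its quotient by every principal ideal is semisimple. Each $\phi$ determines a continuous piecewise linear $\hat\phi\colon[0,1]^n\to[0,1]$ (truth value at valuation $v$, with $\neg x=1-x$, $x\oplus y=\min(1,x+y)$); $\partial\hat\phi(v)/\partial u$ is the one-sided directional derivative at $v$ in direction $u$. $\mathrm{Mod}(\Theta)=\{v\in[0,1]^n\mid\hat\theta(v)=1\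 \forall\theta\in\Theta\}$. $\Theta\models\psi$ iff $\hat\psi=1$ on $\mathrm{Mod}(\Theta)$. Differential valuation in $\mathbb R^n$: for $0\le t\le n$, $U=(u_0,\dots,u_t)$ with $u_1,\dots,u_t$ pairwise orthogonal unit vectors such that for all large integers $m$ the simplex $T_{U,m}=\mathrm{conv}(u_0,\,u_0+u_1/m,\dots,u_0+u_1/m+\cdots+u_t/m^t)\subseteq[0,1]^n$. $U$ satisfies $\psi$ if $\hat\psi=1$ on some $T_{U,m}$. $\Theta\models_\partial\psi$ iff every differential valuation satisfying all $\theta\in\Theta$ satisfies $\psi$. A point of $\mathbb R^n$ is rational if all its coordinates are rational; a rational vector is a nonzero $w\in\mathbb R^n$ whose line $\mathbb Rw$ contains a rational point other than the origin. For closed $X\subseteq\mathbb R^n$, $x\in X$ and a unit vector $u$, $u$ is a Bouligand–Severi tangent vector to $X$ at $x$ if there are $x_i\in X\setminus\{x\}$ with $x_i\to x$ and $(x_i-x)/\|x_i-x\|\to u$; it is outgoing if the open segment $\mathrm{relint}(\mathrm{conv}(x,x+\mu u))$ is disjoint from $X$ for some $\mu>0$. *)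

theory Defs
  imports "HOL-Analysis.Analysis"
begin

section \<open>MV-algebras\<close>

record 'a mv =
  mv_carrier :: "'a set"
  mv_plus :: "'a \<Rightarrow> 'a \<Rightarrow> 'a"
  mv_neg :: "'a \<Rightarrow> 'a"
  mv_zero :: 'a

definition mv_algebra :: "'a mv \<Rightarrow> bool" where
  "mv_algebra A \<longleftrightarrow>
     mv_zero A \<in> mv_carrier A \<and>
     (\<forall>x\<in>mv_carrier A. mv_neg A x \<in> mv_carrier A) \<and>
     (\<forall>x\<in>mv_carrier A. \<forall>y\<in>mv_carrier A. mv_plus A x y \<in> mv_carrier A) \<and>
     (\<forall>x\<in>mv_carrier A. \<forall>y\<in>mv_carrier A. \<forall>z\<in>mv_carrier A.
        mv_plus A x (mv_plus A y z) = mv_plus A (mv_plus A x y) z) \<and>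
     (\<forall>x\<in>mv_carrier A. \<forall>y\<in>mv_carrier A. mv_plus A x y = mv_plus A y x) \<and>
     (\<forall>x\<in>mv_carrier A. mv_plus A x (mv_zero A) = x) \<and>
     (\<forall>x\<in>mv_carrier A. mv_neg A (mv_neg A x) = x) \<and>
     (\<forall>x\<in>mv_carrier A. mv_plus A x (mv_neg A (mv_zero A)) = mv_neg A (mv_zero A)) \<and>
     (\<forall>x\<in>mv_carrier A. \<forall>y\<in>mv_carrier A.
        mv_plus A (mv_neg A (mv_plus A (mv_neg A x) y)) y =
        mv_plus A (mv_neg A (mv_plus A (mv_neg A y) x)) x)"

definition mv_one :: "'a mv \<Rightarrow> 'a" where
  "mv_one A = mv_neg A (mv_zero A)"

definition mv_le :: "'a mv \<Rightarrow> 'a \<Rightarrow> 'a \<Rightarrow> bool" where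
  "mv_le A x y \<longleftrightarrow> mv_plus A (mv_neg A x) y = mv_one A"

definition mv_minus :: "'a mv \<Rightarrow> 'a \<Rightarrow> 'a \<Rightarrow> 'a" where
  "mv_minus A x y = mv_neg A (mv_plus A (mv_neg A x) y)"

definition mv_dist :: "'a mv \<Rightarrow> 'a \<Rightarrow> 'a \<Rightarrow> 'a" where
  "mv_dist A x y = mv_plus A (mv_minus A x y) (mv_minus A y x)"

definition mv_ideal :: "'a mv \<Rightarrow> 'a set \<Rightarrow> bool" where
  "mv_ideal A J \<longleftrightarrow>
     J \<subseteq> mv_carrier A \<and> mv_zero A \<in> J \<and>
     (\<forall>x\<in>J. \<forall>y\<in>J. mv_plus A x y \<in> J) \<and>
     (\<forall>x\<in>J. \<forall>y\<in>mv_carrier A. mv_le A y x \<longrightarrow> y \<in> J)"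

definition mv_maximal_ideal :: "'a mv \<Rightarrow> 'a set \<Rightarrow> bool" where
  "mv_maximal_ideal A J \<longleftrightarrow>
     mv_ideal A J \<and> J \<noteq> mv_carrier A \<and>
     (\<forall>I. mv_ideal A I \<and> J \<subseteq> I \<and> I \<noteq> mv_carrier A \<longrightarrow> I = J)"

definition mv_principal_ideal :: "'a mv \<Rightarrow> 'a \<Rightarrow> 'a set" where
  "mv_principal_ideal A a = \<Inter>{J. mv_ideal A J \<and> a \<in> J}"

definition mv_cong :: "'a mv \<Rightarrow> 'a set \<Rightarrow> ('a \<times> 'a) set" where
  "mv_cong A J =
     {(x, y). x \<in> mv_carrier A \<and> y \<in> mv_carrier A \<and> mv_dist A x y \<in> J}"

definition mv_quotient :: "'a mv \<Rightarrow> 'a set \<Rightarrow> 'a set mv" where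
  "mv_quotient A J =
     \<lparr> mv_carrier = mv_carrier A // mv_cong A J,
       mv_plus = (\<lambda>C D. \<Union>x\<in>C. \<Union>y\<in>D. mv_cong A J `` {mv_plus A x y}),
       mv_neg = (\<lambda>C. \<Union>x\<in>C. mv_cong A J `` {mv_neg A x}),
       mv_zero = mv_cong A J `` {mv_zero A} \<rparr>"

text \<open>The intersection is taken inside the carrier: the one-element MV-algebra, which has no
  maximal ideals, is semisimple.\<close>

definition semisimple :: "'a mv \<Rightarrow> bool" where
  "semisimple A \<longleftrightarrow>
     {x \<in> mv_carrier A. \<forall>J. mv_maximal_ideal A J \<longrightarrow> x \<in> J} = {mv_zero A}"

definition strongly_semisimple :: "'a mv \<Rightarrow> bool" where
  "strongly_semisimple A \<longleftrightarrow>
     (\<forall>a\<in>mv_carrier A. semisimple (mv_quotient A (mv_principal_ideal A a)))"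

section \<open>Infinite-valued Lukasiewicz logic\<close>

text \<open>The finite type \<open>'n\<close> indexes the propositional variables. Negation and implication are
  primitive, as in the standard axiomatization.\<close>

datatype 'n form = Var 'n | Neg "'n form" | Imp "'n form" "'n form"

definition Oplus :: "'n form \<Rightarrow> 'n form \<Rightarrow> 'n form" where
  "Oplus \<phi> \<psi> = Imp (Neg \<phi>) \<psi>"

definition Odot :: "'n form \<Rightarrow> 'n form \<Rightarrow> 'n form" where
  "Odot \<phi> \<psi> = Neg (Imp \<phi> (Neg \<psi>))"

definition Iff :: "'n form \<Rightarrow> 'n form \<Rightarrow> 'n form" where
  "Iff \<phi> \<psi> = Odot (Imp \<phi> \<psi>) (Imp \<psi> \<phi>)"

inductive derivable :: "'n form set \<Rightarrow> 'n form \<Rightarrow> bool" (infix \<open>\<turnstile>\<close> 50) for \<Theta> where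
  hyp: "\<phi> \<in> \<Theta> \<Longrightarrow> \<Theta> \<turnstile> \<phi>"
| A1: "\<Theta> \<turnstile> Imp \<phi> (Imp \<psi> \<phi>)"
| A2: "\<Theta> \<turnstile> Imp (Imp \<phi> \<psi>) (Imp (Imp \<psi> \<xi>) (Imp \<phi> \<xi>))"
| A3: "\<Theta> \<turnstile> Imp (Imp (Imp \<phi> \<psi>) \<psi>) (Imp (Imp \<psi> \<phi>) \<phi>)"
| A4: "\<Theta> \<turnstile> Imp (Imp (Neg \<phi>) (Neg \<psi>)) (Imp \<psi> \<phi>)"
| MP: "\<Theta> \<turnstile> \<phi> \<Longrightarrow> \<Theta> \<turnstile> Imp \<phi> \<psi> \<Longrightarrow> \<Theta> \<turnstile> \<psi>"

definition form_equiv :: "'n form set \<Rightarrow> ('n form \<times> 'n form) set" where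
  "form_equiv \<Theta> = {(\<phi>, \<psi>). \<Theta> \<turnstile> Iff \<phi> \<psi>}"

text \<open>The zero element is the class of all refutable formulas.\<close>

definition LIND :: "'n form set \<Rightarrow> 'n form set mv" where
  "LIND \<Theta> =
     \<lparr> mv_carrier = UNIV // form_equiv \<Theta>,
       mv_plus = (\<lambda>C D. \<Union>\<phi>\<in>C. \<Union>\<psi>\<in>D. form_equiv \<Theta> `` {Oplus \<phi> \<psi>}),
       mv_neg = (\<lambda>C. \<Union>\<phi>\<in>C. form_equiv \<Theta> `` {Neg \<phi>}),
       mv_zero = {\<phi>. \<Theta> \<turnstile> Neg \<phi>} \<rparr>"

subsection \<open>The Lindenbaum algebra is an MV-algebra\<close>

lemma derivable_trans: "\<Theta> \<turnstile> Imp a b \<Longrightarrow> \<Theta> \<turnstile> Imp b c \<Longrightarrow> \<Theta> \<turnstile> Imp a c"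
  by (meson A2 MP)

lemma derivable_assert: "\<Theta> \<turnstile> Imp a (Imp (Imp a b) b)"
  by (rule derivable_trans[OF A1 A3])

lemma derivable_exch: "\<Theta> \<turnstile> Imp (Imp a (Imp b c)) (Imp b (Imp a c))"
proof -
  have "\<Theta> \<turnstile> Imp (Imp (Imp (Imp b c) c) (Imp a c)) (Imp b (Imp a c))"
    by (rule MP[OF derivable_assert A2])
  then show ?thesis by (rule derivable_trans[OF A2])
qed

lemma derivable_refl: "\<Theta> \<turnstile> Imp a a"
  by (rule MP[OF A1 MP[OF A1 derivable_exch]])

lemma derivable_suffix: "\<Theta> \<turnstile> Imp (Imp b c) (Imp (Imp a b) (Imp a c))"
  by (rule MP[OF A2 derivable_exch])

lemma derivable_dne: "\<Theta> \<turnstile> Imp (Neg (Neg a)) a"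
proof -
  obtain t where t: "\<Theta> \<turnstile> t" using derivable_refl by blast
  have "\<Theta> \<turnstile> Imp (Neg (Neg a)) (Imp t a)"
    by (rule derivable_trans[OF derivable_trans[OF A1 A4] A4])
  from MP[OF this derivable_exch] t show ?thesis by (rule MP[rotated])
qed

lemma derivable_dni: "\<Theta> \<turnstile> Imp a (Neg (Neg a))"
  by (rule MP[OF derivable_dne A4])

lemma derivable_contra: "\<Theta> \<turnstile> Imp (Imp a b) (Imp (Neg b) (Neg a))"
proof -
  have 1: "\<Theta> \<turnstile> Imp (Imp a b) (Imp (Neg (Neg a)) b)"
    by (rule MP[OF derivable_dne A2])
  have 2: "\<Theta> \<turnstile> Imp (Imp (Neg (Neg a)) b) (Imp (Neg (Neg a)) (Neg (Neg b)))"
    by (rule MP[OF derivable_dni derivable_suffix])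
  show ?thesis by (rule derivable_trans[OF derivable_trans[OF 1 2] A4])
qed

lemma derivable_Iff: "\<Theta> \<turnstile> Iff a b \<longleftrightarrow> \<Theta> \<turnstile> Imp a b \<and> \<Theta> \<turnstile> Imp b a"
proof -
  have "\<Theta> \<turnstile> p \<and> \<Theta> \<turnstile> q" if "\<Theta> \<turnstile> Neg (Imp p (Neg q))" for p q
  proof -
    have "\<Theta> \<turnstile> Imp (Neg p) (Imp p (Neg q))"
      by (rule derivable_trans[OF A1 A4])
    from MP[OF this derivable_contra] have "\<Theta> \<turnstile> Imp (Neg (Imp p (Neg q))) p"
      by (rule derivable_trans[OF _ derivable_dne])
    moreover have "\<Theta> \<turnstile> Imp (Neg (Imp p (Neg q))) q"
      by (rule derivable_trans[OF MP[OF A1 derivable_contra] derivable_dne])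
    ultimately show ?thesis using that MP by blast
  qed
  moreover have "\<Theta> \<turnstile> Neg (Imp p (Neg q))" if "\<Theta> \<turnstile> p" "\<Theta> \<turnstile> q" for p q
  proof -
    have "\<Theta> \<turnstile> Imp (Imp p (Neg q)) (Neg q)" by (rule MP[OF that(1) derivable_assert])
    from MP[OF this derivable_contra] show ?thesis
      by (rule MP[OF MP[OF that(2) derivable_dni]])
  qed
  ultimately show ?thesis unfolding Iff_def Odot_def by blast
qed

lemma form_equiv_iff: "(a, b) \<in> form_equiv \<Theta> \<longleftrightarrow> \<Theta> \<turnstile> Imp a b \<and> \<Theta> \<turnstile> Imp b a"
  by (simp add: form_equiv_def derivable_Iff)

lemma equiv_form_equiv: "equiv UNIV (form_equiv \<Theta>)"
  by (rule equivI)
    (auto simp: refl_on_def sym_def trans_def form_equiv_iff derivable_refl intro: derivable_trans)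

lemma form_equiv_Neg: "(a, b) \<in> form_equiv \<Theta> \<Longrightarrow> (Neg a, Neg b) \<in> form_equiv \<Theta>"
  unfolding form_equiv_iff using MP derivable_contra by blast

lemma form_equiv_Imp:
  assumes "(a, a') \<in> form_equiv \<Theta>" "(b, b') \<in> form_equiv \<Theta>"
  shows "(Imp a b, Imp a' b') \<in> form_equiv \<Theta>"
proof -
  have "\<Theta> \<turnstile> Imp (Imp p q) (Imp p' q')" if "\<Theta> \<turnstile> Imp p' p" "\<Theta> \<turnstile> Imp q q'" for p q p' q'
    by (rule derivable_trans[OF MP[OF that(1) A2] MP[OF that(2) derivable_suffix]])
  then show ?thesis using assms unfolding form_equiv_iff by blast
qed

lemma form_equiv_Oplus:
  "(a, a') \<in> form_equiv \<Theta> \<Longrightarrow> (b, b') \<in> form_equiv \<Theta> \<Longrightarrow>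
    (Oplus a b, Oplus a' b') \<in> form_equiv \<Theta>"
  unfolding Oplus_def by (intro form_equiv_Imp form_equiv_Neg)

lemma LIND_carrier: "mv_carrier (LIND \<Theta>) = range (\<lambda>\<phi>. form_equiv \<Theta> `` {\<phi>})"
  by (auto simp: LIND_def quotient_def)

lemma LIND_neg: "mv_neg (LIND \<Theta>) (form_equiv \<Theta> `` {\<phi>}) = form_equiv \<Theta> `` {Neg \<phi>}"
  unfolding LIND_def mv.simps
  by (rule UN_equiv_class[OF equiv_form_equiv])
    (auto simp: congruent_def intro!: equiv_class_eq[OF equiv_form_equiv] form_equiv_Neg)

lemma LIND_plus:
  "mv_plus (LIND \<Theta>) (form_equiv \<Theta> `` {\<phi>}) (form_equiv \<Theta> `` {\<psi>}) =
    form_equiv \<Theta> `` {Oplus \<phi> \<psi>}"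
  unfolding LIND_def mv.simps
  by (rule UN_equiv_class2[OF equiv_form_equiv equiv_form_equiv])
    (auto simp: congruent2_def intro!: equiv_class_eq[OF equiv_form_equiv] form_equiv_Oplus)

lemma LIND_zero:
  assumes "\<Theta> \<turnstile> Neg z"
  shows "mv_zero (LIND \<Theta>) = form_equiv \<Theta> `` {z}"
proof -
  have "\<Theta> \<turnstile> Imp z y \<and> \<Theta> \<turnstile> Imp y z" if "\<Theta> \<turnstile> Neg y" for y
    using that assms by (meson A1 A4 MP)
  moreover have "\<Theta> \<turnstile> Neg y" if "\<Theta> \<turnstile> Imp y z" for y
    using that assms by (meson derivable_contra MP)
  ultimately show ?thesis by (auto simp: LIND_def form_equiv_iff)
qed

lemma mv_algebra_LIND: "mv_algebra (LIND \<Theta>)"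
proof -
  let ?R = "form_equiv \<Theta>"
  note eqv = equiv_form_equiv[of \<Theta>]
  have tr: "(a, c) \<in> ?R" if "(a, b) \<in> ?R" "(b, c) \<in> ?R" for a b c
    using that by (auto simp: form_equiv_iff intro: derivable_trans)
  have rf: "(a, a) \<in> ?R" for a by (simp add: form_equiv_iff derivable_refl)
  have sy: "(b, a) \<in> ?R" if "(a, b) \<in> ?R" for a b using that by (auto simp: form_equiv_iff)
  obtain z where z: "\<Theta> \<turnstile> Neg z" using derivable_refl derivable_dni MP by blast
  have dn: "(Neg (Neg a), a) \<in> ?R" for a
    by (simp add: form_equiv_iff derivable_dne derivable_dni)
  have comm1: "\<Theta> \<turnstile> Imp (Imp (Neg a) b) (Imp (Neg b) a)" for a b
    by (rule derivable_trans[OF derivable_contra MP[OF derivable_dne derivable_suffix]])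
  have comm: "(Oplus a b, Oplus b a) \<in> ?R" for a b
    by (simp add: form_equiv_iff Oplus_def comm1)
  have exch: "(Oplus a (Oplus b c), Oplus b (Oplus a c)) \<in> ?R" for a b c
    by (simp add: form_equiv_iff Oplus_def derivable_exch)
  have assoc: "(Oplus a (Oplus b c), Oplus (Oplus a b) c) \<in> ?R" for a b c
    by (meson tr form_equiv_Oplus rf comm exch)
  have taut: "(a, b) \<in> ?R" if "\<Theta> \<turnstile> a" "\<Theta> \<turnstile> b" for a b
    using that by (meson form_equiv_iff A1 MP)
  have zero: "(Oplus a z, a) \<in> ?R" for a
  proof (rule tr[OF comm])
    show "(Oplus z a, a) \<in> ?R"
      unfolding form_equiv_iff Oplus_def using z A1 MP derivable_assert by blast
  qed
  have one: "(Oplus a (Neg z), Neg z) \<in> ?R" for a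
    by (rule taut) (auto simp: Oplus_def intro: z MP[OF z A1])
  have red: "(Oplus (Neg (Oplus (Neg a) b)) b, Imp (Imp a b) b) \<in> ?R" for a b
    unfolding Oplus_def by (intro form_equiv_Imp rf tr[OF dn] dn)
  have luk: "(Oplus (Neg (Oplus (Neg a) b)) b, Oplus (Neg (Oplus (Neg b) a)) a) \<in> ?R" for a b
  proof -
    have "(Imp (Imp a b) b, Imp (Imp b a) a) \<in> ?R" by (simp add: form_equiv_iff A3)
    then show ?thesis by (meson red sy tr)
  qed
  show ?thesis
    unfolding mv_algebra_def LIND_carrier LIND_zero[OF z] ball_simps(9) LIND_neg LIND_plus
    by (intro conjI ballI rangeI equiv_class_eq[OF eqv] assoc comm zero dn one luk)
qed

section \<open>Semantics\<close>

abbreviation unit_cube :: "(real ^ 'n) set" where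
  "unit_cube \<equiv> {v. \<forall>i. 0 \<le> v $ i \<and> v $ i \<le> 1}"

text \<open>Only values on \<open>unit_cube\<close> are meaningful. The clause for implication is the truth function
  of the disjunction (truncated sum) of the negated antecedent with the consequent.\<close>

primrec tval :: "('n::finite) form \<Rightarrow> real ^ 'n \<Rightarrow> real" where
  "tval (Var i) v = v $ i"
| "tval (Neg \<phi>) v = 1 - tval \<phi> v"
| "tval (Imp \<phi> \<psi>) v = min 1 ((1 - tval \<phi> v) + tval \<psi> v)"

lemma tval_range:
  assumes "v \<in> unit_cube"
  shows "0 \<le> tval \<phi> v \<and> tval \<phi> v \<le> 1"
  using assms by (induction \<phi>) auto

lemma tval_Oplus: "tval (Oplus \<phi> \<psi>) v = min 1 (tval \<phi> v + tval \<psi> v)"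
  by (simp add: Oplus_def)

definition Mod :: "('n::finite) form set \<Rightarrow> (real ^ 'n) set" where
  "Mod \<Theta> = {v \<in> unit_cube. \<forall>\<theta>\<in>\<Theta>. tval \<theta> v = 1}"

definition entails :: "('n::finite) form set \<Rightarrow> 'n form \<Rightarrow> bool" (infix \<open>\<Turnstile>\<close> 50) where
  "\<Theta> \<Turnstile> \<psi> \<longleftrightarrow> (\<forall>v\<in>Mod \<Theta>. tval \<psi> v = 1)"

text \<open>A tuple \<open>(u\<^sub>0, \<dots>, u\<^sub>t)\<close> is represented by a list of length \<open>t + 1\<close>.\<close>

definition diff_simplex :: "(real ^ 'n) list \<Rightarrow> nat \<Rightarrow> (real ^ 'n) set" where
  "diff_simplex U m =
     convex hull ((\<lambda>k. U ! 0 + (\<Sum>j = 1..k. (1 / real m ^ j) *\<^sub>R U ! j)) ` {..<length U})"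

definition diff_valuation :: "(real ^ 'n) list \<Rightarrow> bool" where
  "diff_valuation U \<longleftrightarrow>
     1 \<le> length U \<and> length U \<le> CARD('n) + 1 \<and>
     (\<forall>j\<in>{1..<length U}. norm (U ! j) = 1) \<and>
     (\<forall>i\<in>{1..<length U}. \<forall>j\<in>{1..<length U}. i \<noteq> j \<longrightarrow> orthogonal (U ! i) (U ! j)) \<and>
     (\<forall>\<^sub>F m in sequentially. diff_simplex U m \<subseteq> unit_cube)"

text \<open>The simplex on which the truth value is 1 has to lie in the domain \<open>unit_cube\<close> of the
  truth-value functions; this is automatic for large \<open>m\<close>, and the simplices decrease with \<open>m\<close>.\<close>

definition diff_sat :: "(real ^ 'n) list \<Rightarrow> ('n::finite) form \<Rightarrow> bool" where
  "diff_sat U \<psi> \<longleftrightarrow>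
     (\<exists>m\<ge>1. diff_simplex U m \<subseteq> unit_cube \<and> (\<forall>x\<in>diff_simplex U m. tval \<psi> x = 1))"

definition diff_entails :: "('n::finite) form set \<Rightarrow> 'n form \<Rightarrow> bool" (infix \<open>\<Turnstile>\<^sub>\<partial>\<close> 50) where
  "\<Theta> \<Turnstile>\<^sub>\<partial> \<psi> \<longleftrightarrow>
     (\<forall>U. diff_valuation U \<longrightarrow> (\<forall>\<theta>\<in>\<Theta>. diff_sat U \<theta>) \<longrightarrow> diff_sat U \<psi>)"

definition has_dir_deriv :: "(real ^ 'n \<Rightarrow> real) \<Rightarrow> real ^ 'n \<Rightarrow> real ^ 'n \<Rightarrow> real \<Rightarrow> bool" where
  "has_dir_deriv f v u D \<longleftrightarrow>
     ((\<lambda>s. f (v + s *\<^sub>R u)) has_real_derivative D) (at_right 0)"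

section \<open>Bouligand--Severi tangent vectors\<close>

definition rational_point :: "real ^ 'n \<Rightarrow> bool" where
  "rational_point x \<longleftrightarrow> (\<forall>i. x $ i \<in> \<rat>)"

definition rational_vector :: "real ^ 'n \<Rightarrow> bool" where
  "rational_vector w \<longleftrightarrow>
     w \<noteq> 0 \<and> (\<exists>c::real. c *\<^sub>R w \<noteq> 0 \<and> rational_point (c *\<^sub>R w))"

definition BS_tangent :: "(real ^ 'n) set \<Rightarrow> real ^ 'n \<Rightarrow> real ^ 'n \<Rightarrow> bool" where
  "BS_tangent X x u \<longleftrightarrow>
     norm u = 1 \<and>
     (\<exists>s :: nat \<Rightarrow> real ^ 'n.
        (\<forall>i. s i \<in> X - {x}) \<and> s \<longlonglongrightarrow> x \<and>
        (\<lambda>i. (1 / norm (s i - x)) *\<^sub>R (s i - x)) \<longlonglongrightarrow> u)"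

definition outgoing :: "(real ^ 'n) set \<Rightarrow> real ^ 'n \<Rightarrow> real ^ 'n \<Rightarrow> bool" where
  "outgoing X x u \<longleftrightarrow>
     (\<exists>\<mu>>0. rel_interior (convex hull {x, x + \<mu> *\<^sub>R u}) \<inter> X = {})"

end

theory Submission
  imports Defs
begin

text \<open>
  Choose \<open>\<gamma>\<close> with one-set a short rational segment from \<open>v\<close> in direction \<open>u\<close>, and
  \<open>lam\<close> with value 1 at \<open>v\<close> and strictly decreasing along \<open>u\<close>. As \<open>u\<close> is outgoing, \<open>v\<close> is the
  only model of \<open>\<Theta> \<union> {\<gamma>}\<close>, hence \<open>lam\<close> is entailed. Truth functions are positively
  homogeneous around \<open>v\<close> up to a constant, so a formula which is 1 on \<open>Mod \<Theta>\<close> is 1 on an initial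
  segment in every tangent direction; the differential valuation \<open>(v, u)\<close> therefore satisfies
  \<open>\<Theta> \<union> {\<gamma>}\<close>, which gives all the differential claims and also shows that \<open>lam\<close> is not derivable
  from \<open>\<Theta> \<union> {\<gamma>}\<close>.

  The quotient of \<open>LIND \<Theta>\<close> by the principal ideal of the negation of \<open>\<gamma>\<close> is
  \<open>LIND (\<Theta> \<union> {\<gamma>})\<close>. It is not semisimple: the negation of \<open>lam\<close> is nonzero but lies in every
  maximal ideal, because every maximal theory has a model in the cube. This is a form of
  Hoelder's theorem: a maximal theory defines an archimedean MV-chain, and counting how many copies
  of a fixed small element are needed to cover a given element is a homomorphism into the unit
  interval up to an error that vanishes as the small element shrinks.
\<close>

section \<open>Derivability\<close>

lemma derivable_cut:
  assumes "T \<turnstile> \<psi>" "\<And>\<phi>. \<phi> \<in> T \<Longrightarrow> T' \<turnstile> \<phi>"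
  shows "T' \<turnstile> \<psi>"
  using assms by (induction rule: derivable.induct) (auto intro: derivable.intros)

lemma derivable_mono: "T \<turnstile> \<psi> \<Longrightarrow> T \<subseteq> T' \<Longrightarrow> T' \<turnstile> \<psi>"
  by (erule derivable_cut) (blast intro: derivable.hyp)

lemma derivable_exch_rule: "T \<turnstile> Imp a (Imp b c) \<Longrightarrow> T \<turnstile> Imp b (Imp a c)"
  by (rule MP[OF _ derivable_exch])

lemma derivable_contra_rule: "T \<turnstile> Imp a b \<Longrightarrow> T \<turnstile> Imp (Neg b) (Neg a)"
  by (rule MP[OF _ derivable_contra])

lemma derivable_Imp_mono:
  assumes "T \<turnstile> Imp a' a" "T \<turnstile> Imp b b'"
  shows "T \<turnstile> Imp (Imp a b) (Imp a' b')"
  by (rule derivable_trans[OF MP[OF assms(1) A2] MP[OF assms(2) derivable_suffix]])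

lemma derivable_weaken: "T \<turnstile> b \<Longrightarrow> T \<turnstile> Imp a b"
  by (rule MP[OF _ A1])

lemma derivable_explosion: "T \<turnstile> Imp a (Imp (Neg a) c)"
  by (rule derivable_exch_rule[OF derivable_trans[OF A1 A4]])

lemma derivable_contra_Neg: "T \<turnstile> Imp (Imp (Neg a) b) (Imp (Neg b) a)"
  by (rule derivable_trans[OF derivable_contra MP[OF derivable_dne derivable_suffix]])

lemma derivable_contra_Neg2: "T \<turnstile> Imp (Imp a (Neg b)) (Imp b (Neg a))"
  by (rule derivable_trans[OF derivable_contra MP[OF derivable_dni A2]])

text \<open>\<open>Neg (Imp a b)\<close> stands for the strong conjunction of \<open>a\<close> and \<open>Neg b\<close>.\<close>

lemma derivable_residuation: "T \<turnstile> Imp a (Imp (Neg b) c) \<Longrightarrow> T \<turnstile> Imp (Neg (Imp a b)) c"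
proof -
  assume "T \<turnstile> Imp a (Imp (Neg b) c)"
  then have "T \<turnstile> Imp a (Imp (Neg c) b)"
    by (rule derivable_trans[OF _ derivable_contra_Neg])
  then have "T \<turnstile> Imp (Neg c) (Imp a b)"
    by (rule derivable_exch_rule)
  then show ?thesis
    by (rule MP[OF _ derivable_contra_Neg])
qed

text \<open>Divisibility: the meet of \<open>y\<close> and \<open>z\<close>, written as the conjunction of \<open>y\<close> with
  \<open>y\<close> implies \<open>z\<close>, is symmetric.\<close>

lemma derivable_divisibility:
  assumes "T \<turnstile> Imp z (Imp (Imp z y) c)"
  shows "T \<turnstile> Imp y (Imp (Imp y z) c)"
proof -
  have "T \<turnstile> Imp (Imp z y) (Imp (Neg c) (Neg z))"
    by (rule derivable_trans[OF derivable_exch_rule[OF assms] derivable_contra])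
  then have 1: "T \<turnstile> Imp (Neg c) (Imp (Imp z y) (Neg z))"
    by (rule derivable_exch_rule)
  have 2: "T \<turnstile> Imp (Imp (Imp z y) (Neg z)) (Imp (Imp (Neg y) (Neg z)) (Neg z))"
    by (rule derivable_Imp_mono[OF A4 derivable_refl])
  have 3: "T \<turnstile> Imp (Imp (Imp (Neg z) (Neg y)) (Neg y)) (Imp (Imp y z) (Neg y))"
    by (rule derivable_Imp_mono[OF derivable_contra derivable_refl])
  have "T \<turnstile> Imp (Neg c) (Imp (Imp y z) (Neg y))"
    by (rule derivable_trans[OF 1 derivable_trans[OF 2 derivable_trans[OF A3 3]]])
  then have "T \<turnstile> Imp (Imp y z) (Imp y c)"
    by (rule derivable_trans[OF derivable_exch_rule A4])
  then show ?thesis by (rule derivable_exch_rule)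
qed

text \<open>It is shown that \<open>Neg p\<close> and \<open>Imp q p\<close> together yield the
  contradiction \<open>c\<close>. \<open>Neg p\<close> is the strong conjunction of \<open>a\<close>
  and \<open>Neg b\<close> and contradicts \<open>Imp (Neg b) z\<close> (fact 2), while
  \<open>Imp q p\<close> yields \<open>Imp (Neg b) z\<close> (fact 3). Fact 2 uses divisibility
  twice: once to exchange the meet of \<open>Neg q\<close> and \<open>a\<close>, once for that of
  \<open>z\<close> and \<open>Neg b\<close>.\<close>

lemma derivable_prelinear: "T \<turnstile> Imp (Imp (Imp b a) (Imp a b)) (Imp a b)"
proof -
  define p where "p = Imp a b"
  define q where "q = Imp b a"
  define z where "z = Imp a (Neg q)"
  define c where "c = Neg (Imp a a)"
  have "T \<turnstile> Imp (Neg z) a"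
    unfolding z_def
    by (rule MP[OF derivable_exch_rule[OF derivable_explosion] derivable_contra_Neg])
  then have 1: "T \<turnstile> Imp (Neg z) (Imp (Neg a) c)"
    by (rule derivable_trans[OF _ derivable_explosion])
  have "T \<turnstile> Imp b (Imp (Imp b (Neg z)) (Neg z))"
    by (rule derivable_assert)
  then have "T \<turnstile> Imp b (Imp (Imp b (Neg z)) (Imp (Neg a) c))"
    by (rule derivable_trans[OF _ derivable_Imp_mono[OF derivable_refl 1]])
  then have "T \<turnstile> Imp b (Imp (Imp z (Neg b)) (Imp (Neg a) c))"
    by (rule derivable_trans[OF _ derivable_Imp_mono[OF derivable_contra_Neg2 derivable_refl]])
  then have "T \<turnstile> Imp b (Imp (Neg a) (Imp (Imp z (Neg b)) c))"
    by (rule derivable_trans[OF _ derivable_exch])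
  then have "T \<turnstile> Imp (Neg q) (Imp (Imp z (Neg b)) c)"
    unfolding q_def by (rule derivable_residuation)
  then have "T \<turnstile> Imp (Neg q) (Imp (Imp (Neg q) a) (Imp (Imp z (Neg b)) c))"
    by (rule derivable_trans[OF _ A1])
  then have "T \<turnstile> Imp a (Imp z (Imp (Imp z (Neg b)) c))"
    unfolding z_def by (rule derivable_divisibility)
  then have "T \<turnstile> Imp z (Imp a (Imp (Imp z (Neg b)) c))"
    by (rule derivable_exch_rule)
  then have "T \<turnstile> Imp z (Imp (Imp z (Neg b)) (Imp a c))"
    by (rule derivable_trans[OF _ derivable_exch])
  then have "T \<turnstile> Imp (Neg b) (Imp (Imp (Neg b) z) (Imp a c))"
    by (rule derivable_divisibility)
  then have "T \<turnstile> Imp (Neg b) (Imp a (Imp (Imp (Neg b) z) c))"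
    by (rule derivable_trans[OF _ derivable_exch])
  then have 2: "T \<turnstile> Imp (Neg p) (Imp (Imp (Neg b) z) c)"
    unfolding p_def by (rule derivable_residuation[OF derivable_exch_rule])
  have "T \<turnstile> Imp (Neg b) (Imp a (Neg p))"
    unfolding p_def
    by (rule derivable_exch_rule[OF derivable_trans[OF derivable_assert derivable_contra]])
  then have "T \<turnstile> Imp (Imp (Imp a (Neg p)) z) (Imp (Neg b) z)"
    by (rule MP[OF _ A2])
  moreover have "T \<turnstile> Imp (Imp (Neg p) (Neg q)) (Imp (Imp a (Neg p)) z)"
    unfolding z_def by (rule derivable_suffix)
  ultimately have 3: "T \<turnstile> Imp (Imp q p) (Imp (Neg b) z)"
    by (rule derivable_trans[OF derivable_contra derivable_trans[rotated]])
  have "T \<turnstile> Imp (Neg p) (Imp (Imp q p) c)"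
    by (rule derivable_trans[OF 2 MP[OF 3 A2]])
  then have "T \<turnstile> Imp (Imp q p) (Imp (Neg p) c)"
    by (rule derivable_exch_rule)
  then have "T \<turnstile> Imp (Imp q p) (Imp (Imp a a) p)"
    unfolding c_def by (rule derivable_trans[OF _ A4])
  then have "T \<turnstile> Imp (Imp a a) (Imp (Imp q p) p)"
    by (rule derivable_exch_rule)
  then show ?thesis
    unfolding p_def q_def by (rule MP[OF derivable_refl])
qed

text \<open>\<open>Imp (Imp a b) b\<close> is the join of \<open>a\<close> and \<open>b\<close>.
  After \<open>a\<close> is replaced by \<open>c\<close>, axiom \<open>A3\<close> swaps the join of
  \<open>c\<close> and \<open>b\<close>, and only \<open>Imp b c\<close> remains to be
  discharged.\<close>

lemma derivable_disj_elim:
  assumes "T \<turnstile> Imp a c" "T \<turnstile> Imp b c"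
  shows "T \<turnstile> Imp (Imp (Imp a b) b) c"
proof -
  have "T \<turnstile> Imp (Imp (Imp a b) b) (Imp (Imp c b) b)"
    by (intro derivable_Imp_mono assms derivable_refl)
  then have "T \<turnstile> Imp (Imp (Imp a b) b) (Imp (Imp b c) c)"
    by (rule derivable_trans[OF _ A3])
  then show ?thesis by (rule MP[OF assms(2) derivable_exch_rule])
qed

section \<open>Local deduction and case distinction with powers\<close>

primrec impn :: "'n form \<Rightarrow> nat \<Rightarrow> 'n form \<Rightarrow> 'n form" where
  "impn a 0 b = b"
| "impn a (Suc k) b = Imp a (impn a k b)"

lemma impn_add: "impn a (i + j) b = impn a i (impn a j b)"
  by (induction i) auto

lemma derivable_impn_mono: "T \<turnstile> Imp b c \<Longrightarrow> T \<turnstile> Imp (impn a k b) (impn a k c)"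
  by (induction k) (auto intro: derivable_Imp_mono derivable_refl)

lemma derivable_impn_weaken: "T \<turnstile> Imp b (impn a k b)"
  by (induction k) (auto intro: derivable_refl derivable_trans A1)

lemma derivable_impn_exch: "T \<turnstile> Imp (impn a k (Imp b c)) (Imp b (impn a k c))"
proof (induction k)
  case (Suc k)
  then have "T \<turnstile> Imp (Imp a (impn a k (Imp b c))) (Imp a (Imp b (impn a k c)))"
    by (intro derivable_Imp_mono derivable_refl)
  then show ?case using derivable_trans[OF _ derivable_exch] by simp
qed (simp add: derivable_refl)

text \<open>Contraction fails in this logic, so the uses of \<open>a\<close> are counted:
  \<open>impn a k b\<close> expresses that the \<open>k\<close>-th power of \<open>a\<close> under
  strong conjunction implies \<open>b\<close>, and Modus Ponens adds the exponents.\<close>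

lemma local_deduction:
  assumes "insert a T \<turnstile> b"
  shows "\<exists>k. T \<turnstile> impn a k b"
  using assms
proof (induction rule: derivable.induct)
  case (hyp \<phi>)
  have "T \<turnstile> impn a 1 a" by (simp add: derivable_refl)
  moreover have "T \<turnstile> impn a 0 \<phi>" if "\<phi> \<in> T" using that by (simp add: derivable.hyp)
  ultimately show ?case using hyp by blast
next
  case (MP \<phi> \<psi>)
  then obtain i j where ij: "T \<turnstile> impn a i \<phi>" "T \<turnstile> impn a j (Imp \<phi> \<psi>)" by blast
  have "T \<turnstile> Imp \<phi> (impn a j \<psi>)"
    using ij(2) derivable_impn_exch derivable.MP by blast
  then have "T \<turnstile> Imp (impn a i \<phi>) (impn a i (impn a j \<psi>))"
    by (rule derivable_impn_mono)
  then have "T \<turnstile> impn a (i + j) \<psi>"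
    unfolding impn_add using ij(1) derivable.MP by blast
  then show ?case ..
qed (metis derivable.A1 derivable.A2 derivable.A3 derivable.A4 impn.simps(1))+

text \<open>If a join is the top element, so is the join of any powers of its two members. Factors
  are stripped one at a time: the inner claim removes those of \<open>b\<close> against a single
  \<open>a\<close>, the outer induction those of \<open>a\<close>.\<close>

lemma derivable_impn_disj_elim:
  assumes "T \<turnstile> impn a i c" "T \<turnstile> impn b j c" "T \<turnstile> Imp (Imp a b) b"
  shows "T \<turnstile> c"
proof -
  have 1: "T \<turnstile> d" if "T \<turnstile> Imp a d" "T \<turnstile> impn b j d" for d j
    using that
  proof (induction j)
    case (Suc j)
    have "T \<turnstile> Imp a (impn b j d)"
      by (rule derivable_trans[OF Suc.prems(1) derivable_impn_weaken])
    moreover have "T \<turnstile> Imp b (impn b j d)" using Suc.prems(2) by simp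
    ultimately have "T \<turnstile> impn b j d"
      using derivable_disj_elim assms(3) MP by blast
    then show ?case using Suc by blast
  qed simp
  show ?thesis using assms(1)
  proof (induction i)
    case (Suc i)
    have "T \<turnstile> impn b j (impn a i c)"
      using derivable_impn_mono[OF derivable_impn_weaken] assms(2) MP by blast
    then have "T \<turnstile> impn a i c" using 1 Suc.prems by simp
    then show ?case by (rule Suc.IH)
  qed simp
qed

section \<open>Truncated sums and differences\<close>

lemma derivable_Oplus_mono:
  "T \<turnstile> Imp a a' \<Longrightarrow> T \<turnstile> Imp b b' \<Longrightarrow> T \<turnstile> Imp (Oplus a b) (Oplus a' b')"
  unfolding Oplus_def by (intro derivable_Imp_mono derivable_contra_rule)

lemma derivable_Oplus_comm: "T \<turnstile> Imp (Oplus a b) (Oplus b a)"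
  unfolding Oplus_def by (rule derivable_contra_Neg)

lemma derivable_Oplus_right: "T \<turnstile> Imp b (Oplus a b)"
  unfolding Oplus_def by (rule A1)

lemma derivable_Oplus_left: "T \<turnstile> Imp a (Oplus a b)"
  unfolding Oplus_def by (rule derivable_explosion)

lemma derivable_Oplus_exch: "T \<turnstile> Imp (Oplus a (Oplus b c)) (Oplus b (Oplus a c))"
  unfolding Oplus_def by (rule derivable_exch)

lemma derivable_Oplus_assoc:
  "T \<turnstile> Imp (Oplus (Oplus a b) c) (Oplus a (Oplus b c))"
  "T \<turnstile> Imp (Oplus a (Oplus b c)) (Oplus (Oplus a b) c)"
  by (meson derivable_trans derivable_refl derivable_Oplus_mono derivable_Oplus_comm
      derivable_Oplus_exch)+

text \<open>The first hypothesis says that the sum of \<open>a\<close> and \<open>b\<close> is not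
  truncated. \<open>Imp (Oplus a b) b\<close> is the join of \<open>Neg a\<close> and
  \<open>b\<close>, which then collapses to \<open>Neg a\<close>.\<close>

lemma derivable_Oplus_cancel:
  assumes "T \<turnstile> Imp a (Neg b)" "T \<turnstile> Imp (Oplus a b) (Oplus x b)"
  shows "T \<turnstile> Imp a x"
proof -
  have "T \<turnstile> Imp (Imp (Oplus x b) b) (Imp (Oplus a b) b)"
    by (rule MP[OF assms(2) A2])
  then have "T \<turnstile> Imp (Neg x) (Imp (Oplus a b) b)"
    unfolding Oplus_def by (rule derivable_trans[OF derivable_assert])
  then have "T \<turnstile> Imp (Neg x) (Imp (Imp b (Neg a)) (Neg a))"
    unfolding Oplus_def by (rule derivable_trans[OF _ A3])
  moreover have "T \<turnstile> Imp b (Neg a)"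
    by (rule MP[OF assms(1) derivable_contra_Neg2])
  ultimately have "T \<turnstile> Imp (Neg x) (Neg a)"
    using MP derivable_exch_rule by blast
  then show ?thesis by (rule MP[OF _ A4])
qed

text \<open>\<open>Neg (Imp a x)\<close> is the truncated difference of \<open>a\<close> and
  \<open>x\<close>. Adding \<open>x\<close> back gives the join of the two, and this is
  \<open>a\<close> because \<open>x\<close> lies below it.\<close>

lemma derivable_Oplus_diff:
  assumes "T \<turnstile> Imp x a"
  shows "T \<turnstile> Imp (Oplus (Neg (Imp a x)) x) a"
proof -
  have "T \<turnstile> Imp (Oplus (Neg (Imp a x)) x) (Imp (Imp a x) x)"
    unfolding Oplus_def by (rule MP[OF derivable_dni A2])
  then show ?thesis
    by (rule derivable_trans[OF _ derivable_disj_elim[OF derivable_refl assms]])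
qed

text \<open>The language has no truth constants, so falsity is built from an arbitrary
  variable.\<close>

definition Bot :: "'n form" where
  "Bot = Neg (Imp (Var undefined) (Var undefined))"

lemma derivable_Bot: "T \<turnstile> Imp Bot a"
  unfolding Bot_def by (rule MP[OF derivable_refl derivable_explosion])

lemma derivable_Neg_Bot: "T \<turnstile> Neg Bot"
  unfolding Bot_def by (rule MP[OF derivable_refl derivable_dni])

section \<open>Models of maximal theories\<close>

lemma continuous_tval: "continuous_on UNIV (tval \<phi>)"
  by (induction \<phi>) (auto intro!: continuous_intros)

text \<open>The multiple of \<open>e\<close> is written through \<open>impn\<close> so that local
  deduction applied to \<open>Neg e\<close> produces it directly.\<close>

definition nsum :: "nat \<Rightarrow> 'n form \<Rightarrow> 'n form" where
  "nsum k e = impn (Neg e) k Bot"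

lemma nsum_0: "nsum 0 e = Bot"
  by (simp add: nsum_def)

lemma nsum_Suc: "nsum (Suc k) e = Oplus e (nsum k e)"
  by (simp add: nsum_def Oplus_def)

lemma derivable_Oplus_Bot: "T \<turnstile> Imp (Oplus Bot a) a"
  unfolding Oplus_def by (rule MP[OF derivable_Neg_Bot derivable_assert])

lemma derivable_nsum_mono: "i \<le> j \<Longrightarrow> T \<turnstile> Imp (nsum i e) (nsum j e)"
  by (induction rule: dec_induct)
    (auto simp: nsum_Suc intro: derivable_refl derivable_trans derivable_Oplus_right)

lemma derivable_nsum_add:
  "T \<turnstile> Imp (Oplus (nsum i e) (nsum j e)) (nsum (i + j) e)"
  "T \<turnstile> Imp (nsum (i + j) e) (Oplus (nsum i e) (nsum j e))"
proof (induction i)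
  case (Suc i)
  {
    case 1
    show ?case
      using derivable_trans[OF derivable_Oplus_assoc(1) derivable_Oplus_mono[OF derivable_refl Suc(1)]]
      by (simp add: nsum_Suc)
  next
    case 2
    show ?case
      using derivable_trans[OF derivable_Oplus_mono[OF derivable_refl Suc(2)] derivable_Oplus_assoc(2)]
      by (simp add: nsum_Suc)
  }
qed (auto simp: nsum_0 derivable_Oplus_Bot derivable_Oplus_right)

locale maximal_theory =
  fixes T :: "('n::finite) form set"
  assumes consistent: "\<not> T \<turnstile> Bot"
    and maximal: "\<not> T \<turnstile> a \<Longrightarrow> insert a T \<turnstile> b"
begin

text \<open>If neither implication were derivable, adding either one would explode. Local deduction
  then makes a power of each contradictory, although by prelinearity their join is
  derivable.\<close>

lemma linear: "T \<turnstile> Imp a b \<or> T \<turnstile> Imp b a"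
proof (rule ccontr)
  assume "\<not> ?thesis"
  then have "insert (Imp a b) T \<turnstile> Bot" "insert (Imp b a) T \<turnstile> Bot"
    using maximal by blast+
  then obtain i j where "T \<turnstile> impn (Imp a b) i Bot" "T \<turnstile> impn (Imp b a) j Bot"
    using local_deduction by metis
  then show False
    using derivable_impn_disj_elim derivable_prelinear consistent by blast
qed

lemma archimedean: "\<not> T \<turnstile> Neg e \<Longrightarrow> \<exists>k. T \<turnstile> nsum k e"
  unfolding nsum_def using local_deduction maximal by blast

end

text \<open>\<open>e\<close> is a nonzero element of the simple MV-chain given by \<open>T\<close>, and
  \<open>steps a\<close> measures \<open>a\<close> in multiples of \<open>e\<close>, rounding up.\<close>

locale scale = maximal_theory +
  fixes e :: "('n::finite) form"
  assumes nonzero: "\<not> T \<turnstile> Neg e"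
begin

definition steps :: "'n form \<Rightarrow> nat" where
  "steps a = (LEAST k. T \<turnstile> Imp a (nsum k e))"

definition N :: nat where
  "N = (LEAST k. T \<turnstile> nsum k e)"

lemma nsum_N: "T \<turnstile> nsum N e"
  unfolding N_def using archimedean[OF nonzero] by (rule LeastI_ex)

text \<open>\<open>N\<close> copies of \<open>e\<close> cover everything, so the least number
  exists, and the set of covering numbers is upward closed.\<close>

lemma steps_le_iff: "steps a \<le> k \<longleftrightarrow> T \<turnstile> Imp a (nsum k e)"
proof -
  have "T \<turnstile> Imp a (nsum (steps a) e)"
    unfolding steps_def by (rule LeastI[of _ N]) (rule derivable_weaken[OF nsum_N])
  then show ?thesis
    using derivable_trans[OF _ derivable_nsum_mono] Least_le[of "\<lambda>k. T \<turnstile> Imp a (nsum k e)" k]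
    unfolding steps_def by blast
qed

lemma N_pos: "N > 0"
  using nsum_N consistent by (metis gr0I nsum_0)

lemma steps_le_N: "steps a \<le> N"
  unfolding steps_le_iff by (rule derivable_weaken[OF nsum_N])

lemma steps_derivable:
  assumes "T \<turnstile> a"
  shows "steps a = N"
proof -
  have "T \<turnstile> nsum (steps a) e" using steps_le_iff[of a "steps a"] assms MP by blast
  then have "N \<le> steps a" unfolding N_def by (rule Least_le)
  then show ?thesis using steps_le_N[of a] by simp
qed

lemma steps_mono: "T \<turnstile> Imp a b \<Longrightarrow> steps a \<le> steps b"
  using steps_le_iff[of b "steps b"] steps_le_iff[of a "steps b"] derivable_trans by blast

lemma nsum_le: "k < steps a \<Longrightarrow> T \<turnstile> Imp (nsum k e) a"
  using steps_le_iff[of a k] linear[of a "nsum k e"] by auto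

lemma steps_Oplus_le: "steps (Oplus a b) \<le> steps a + steps b"
proof -
  have "T \<turnstile> Imp (Oplus a b) (Oplus (nsum (steps a) e) (nsum (steps b) e))"
    using steps_le_iff by (intro derivable_Oplus_mono) blast+
  then show ?thesis
    unfolding steps_le_iff by (rule derivable_trans[OF _ derivable_nsum_add(1)])
qed

text \<open>If fewer copies covered the sum, \<open>j\<close> of them could be replaced by
  \<open>b\<close>, and cancelling \<open>b\<close> would cover \<open>a\<close> with one copy less
  than \<open>steps a\<close>. Cancellation applies because the first hypothesis makes the sum
  untruncated.\<close>

lemma steps_Oplus_ge:
  assumes "T \<turnstile> Imp a (Neg b)" "T \<turnstile> Imp (nsum j e) b" "j \<le> steps b"
  shows "steps a + j \<le> steps (Oplus a b)"
proof (cases "steps a")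
  case 0
  then show ?thesis using assms(3) steps_mono[OF derivable_Oplus_right, of b a] by simp
next
  case (Suc i)
  show ?thesis
  proof (rule ccontr)
    assume "\<not> ?thesis"
    then have "steps (Oplus a b) \<le> i + j" using Suc by simp
    then have "T \<turnstile> Imp (Oplus a b) (nsum (i + j) e)" by (simp add: steps_le_iff)
    then have "T \<turnstile> Imp (Oplus a b) (Oplus (nsum i e) b)"
      by (meson derivable_trans derivable_nsum_add(2) derivable_Oplus_mono derivable_refl assms(2))
    then have "T \<turnstile> Imp a (nsum i e)" by (rule derivable_Oplus_cancel[OF assms(1)])
    then show False using Suc steps_le_iff[of a i] by simp
  qed
qed

definition point :: "real ^ 'n" where
  "point = (\<chi> i. real (steps (Var i)) / real N)"

lemma point_in_cube: "point \<in> unit_cube"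
  using steps_le_N N_pos by (auto simp: point_def)

text \<open>\<open>d\<close> bounds the gap between the copies of \<open>e\<close> that fit below an
  element and those needed to cover it. On untruncated sums \<open>steps\<close> is additive up to
  \<open>d\<close>, so each connective adds at most \<open>d\<close> to the error, whence the factor
  \<open>size \<phi>\<close>.\<close>

lemma steps_approx_tval:
  fixes d :: nat
  assumes below: "\<And>b. \<exists>j. T \<turnstile> Imp (nsum j e) b \<and> j \<le> steps b \<and> steps b \<le> j + d"
  shows "\<bar>real (steps \<phi>) - real N * tval \<phi> point\<bar> \<le> real d * real (size \<phi>)"
proof (induction \<phi>)
  case (Var i)
  then show ?case using N_pos by (simp add: point_def)
next
  have add: "steps a + steps b \<le> steps (Oplus a b) + d" if "T \<turnstile> Imp a (Neg b)" for a b
  proof -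
    obtain j where j: "T \<turnstile> Imp (nsum j e) b" "j \<le> steps b" "steps b \<le> j + d" using below by blast
    then show ?thesis using steps_Oplus_ge[OF that j(1,2)] by simp
  qed
  have neg: "N \<le> steps (Neg a) + steps a" "steps (Neg a) + steps a \<le> N + d" for a
  proof -
    have "steps (Oplus (Neg a) a) = N"
      unfolding Oplus_def by (rule steps_derivable[OF derivable_dne])
    then show "N \<le> steps (Neg a) + steps a" "steps (Neg a) + steps a \<le> N + d"
      using steps_Oplus_le[of "Neg a" a] add[OF derivable_refl, of a] by simp_all
  qed
  {
    case (Neg a)
    have "\<bar>real (steps (Neg a)) - (real N - real (steps a))\<bar> \<le> real d"
      using neg[of a] by linarith
    then show ?case using Neg by (simp add: algebra_simps abs_le_iff)
  next
    case (Imp a b)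
    define m where "m = min (real N) (real N - real (steps a) + real (steps b))"
    have 1: "\<bar>real (steps (Imp a b)) - m\<bar> \<le> real d"
    proof (cases "T \<turnstile> Imp a b")
      case True
      then show ?thesis using steps_derivable steps_mono[OF True] by (simp add: m_def)
    next
      case False
      \<comment> \<open>By linearity \<open>b\<close> lies below \<open>a\<close>, hence
        \<open>Neg a\<close> below \<open>Neg b\<close>, and \<open>Oplus (Neg a) b\<close> is an
        untruncated sum.\<close>
      then have ba: "T \<turnstile> Imp b a" using linear by blast
      have "T \<turnstile> Imp (Oplus (Neg a) b) (Imp a b)" "T \<turnstile> Imp (Imp a b) (Oplus (Neg a) b)"
        unfolding Oplus_def by (intro derivable_Imp_mono derivable_refl derivable_dni derivable_dne)+
      then have "steps (Oplus (Neg a) b) = steps (Imp a b)"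
        using steps_mono by (simp add: antisym)
      moreover have "T \<turnstile> Imp (Neg a) (Neg b)" using ba by (rule derivable_contra_rule)
      ultimately have "steps (Neg a) + steps b \<le> steps (Imp a b) + d"
        "steps (Imp a b) \<le> steps (Neg a) + steps b"
        using add steps_Oplus_le by metis+
      then show ?thesis using neg[of a] steps_mono[OF ba] unfolding m_def by linarith
    qed
    have "real N * tval (Imp a b) point
        = min (real N) (real N - real N * tval a point + real N * tval b point)"
      using N_pos by (simp add: min_def field_simps)
    then have "\<bar>m - real N * tval (Imp a b) point\<bar> \<le> real d * real (size a) + real d * real (size b)"
      using Imp unfolding m_def by linarith
    then show ?case using 1 by (simp add: algebra_simps)
  }
qed

end

section \<open>Valuations satisfying a maximal theory: with and without an atom\<close>

context maximal_theory
begin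

text \<open>Here \<open>e\<close> is an atom, so every element is an exact multiple of it; the
  approximation holds with error 0 and \<open>point\<close> itself is a model.\<close>

lemma exists_model_atomic:
  assumes "\<not> T \<turnstile> Neg e" and atom: "\<And>x. \<not> T \<turnstile> Neg x \<Longrightarrow> T \<turnstile> Imp e x"
  shows "\<exists>w\<in>unit_cube. \<forall>\<phi>. T \<turnstile> \<phi> \<longrightarrow> tval \<phi> w = 1"
proof -
  interpret scale T e using assms(1) by unfold_locales
  have "T \<turnstile> Imp (nsum (steps b) e) b" for b
  proof (cases "steps b")
    case 0
    then show ?thesis by (simp add: nsum_0 derivable_Bot)
  next
    case (Suc i)
    then have i: "\<not> T \<turnstile> Imp b (nsum i e)" "T \<turnstile> Imp (nsum i e) b"
      using steps_le_iff[of b i] nsum_le[of i b] by auto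
    \<comment> \<open>The difference of \<open>b\<close> and \<open>nsum i e\<close> is nonzero, so
      it lies above the atom and one more copy of \<open>e\<close> still fits below
      \<open>b\<close>.\<close>
    then have "\<not> T \<turnstile> Neg (Neg (Imp b (nsum i e)))" using derivable_dne MP by blast
    then have "T \<turnstile> Imp e (Neg (Imp b (nsum i e)))" by (rule atom)
    then have "T \<turnstile> Imp (Oplus e (nsum i e)) (Oplus (Neg (Imp b (nsum i e))) (nsum i e))"
      by (intro derivable_Oplus_mono derivable_refl)
    then show ?thesis
      unfolding Suc nsum_Suc by (rule derivable_trans[OF _ derivable_Oplus_diff[OF i(2)]])
  qed
  then have "\<bar>real (steps \<phi>) - real N * tval \<phi> point\<bar> \<le> real 0 * real (size \<phi>)" for \<phi>
    by (intro steps_approx_tval) auto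
  then have "real (steps \<phi>) = real N * tval \<phi> point" for \<phi> by simp
  then have "tval \<phi> point = 1" if "T \<turnstile> \<phi>" for \<phi>
    using steps_derivable[OF that] N_pos
    by (metis mult_cancel_left2 of_nat_0_eq_iff neq0_conv)
  then show ?thesis using point_in_cube by blast
qed

text \<open>Without atoms some nonzero \<open>x\<close> lies strictly below \<open>e\<close>, so the
  difference of \<open>e\<close> and \<open>x\<close> is nonzero too. Two copies of the smaller of
  these parts fit below \<open>e\<close>, and iteration gives the powers of 2.\<close>

lemma exists_small:
  assumes no_atom: "\<And>e. \<not> T \<turnstile> Neg e \<Longrightarrow> \<exists>x. \<not> T \<turnstile> Neg x \<and> \<not> T \<turnstile> Imp e x"
  shows "\<not> T \<turnstile> Neg e \<Longrightarrow> \<exists>d. \<not> T \<turnstile> Neg d \<and> T \<turnstile> Imp (nsum (2 ^ k) d) e"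
proof (induction k arbitrary: e)
  case 0
  have "T \<turnstile> Imp (nsum (2 ^ 0) e) e"
    using derivable_trans[OF derivable_Oplus_comm derivable_Oplus_Bot] by (simp add: nsum_Suc nsum_0)
  then show ?case using 0 by blast
next
  case (Suc k)
  obtain x where x: "\<not> T \<turnstile> Neg x" "\<not> T \<turnstile> Imp e x" using no_atom Suc.prems by blast
  let ?y = "Neg (Imp e x)"
  have y: "\<not> T \<turnstile> Neg ?y" using x(2) derivable_dne MP by blast
  have xy: "T \<turnstile> Imp (Oplus ?y x) e" using linear x(2) derivable_Oplus_diff by blast
  obtain d where d: "\<not> T \<turnstile> Neg d" "T \<turnstile> Imp d ?y" "T \<turnstile> Imp d x"
    using linear[of x ?y] x y derivable_refl by blast
  then have "T \<turnstile> Imp (Oplus d d) e" using xy derivable_Oplus_mono derivable_trans by blast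
  moreover obtain d' where d': "\<not> T \<turnstile> Neg d'" "T \<turnstile> Imp (nsum (2 ^ k) d') d"
    using Suc.IH d(1) by blast
  moreover have "T \<turnstile> Imp (nsum (2 ^ Suc k) d') (Oplus d d)"
    using derivable_trans[OF derivable_nsum_add(2) derivable_Oplus_mono[OF d'(2) d'(2)]]
    by (simp add: mult_2)
  ultimately have "T \<turnstile> Imp (nsum (2 ^ Suc k) d') e" by (blast intro: derivable_trans)
  then show ?case using d'(1) by blast
qed

text \<open>Ever finer scales give valuations at which a theorem misses the value 1 by at most its
  size divided by \<open>Suc k\<close>. The cube is compact and truth functions are continuous, so a
  limit point is a model.\<close>

lemma exists_model_atomless:
  assumes no_atom: "\<And>e. \<not> T \<turnstile> Neg e \<Longrightarrow> \<exists>x. \<not> T \<turnstile> Neg x \<and> \<not> T \<turnstile> Imp e x"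
  shows "\<exists>w\<in>unit_cube. \<forall>\<phi>. T \<turnstile> \<phi> \<longrightarrow> tval \<phi> w = 1"
proof -
  have "\<not> T \<turnstile> Neg (Neg Bot)" using consistent derivable_dne MP by blast
  \<comment> \<open>\<open>e\<close> is not the top element, so copies of \<open>d\<close> that fit
    below \<open>e\<close> cannot cover everything; this forces \<open>N\<close> above
    \<open>2 ^ k\<close>.\<close>
  then obtain e where e: "\<not> T \<turnstile> Neg e" "\<not> T \<turnstile> Imp (Neg Bot) e" using no_atom by blast
  have "\<exists>w\<in>unit_cube. \<forall>\<phi>. T \<turnstile> \<phi> \<longrightarrow> 1 - tval \<phi> w \<le> real (size \<phi>) / real (Suc k)" for k
  proof -
    obtain d where d: "\<not> T \<turnstile> Neg d" "T \<turnstile> Imp (nsum (2 ^ k) d) e"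
      using exists_small[OF no_atom e(1)] by blast
    interpret scale T d using d(1) by unfold_locales
    have "\<not> N \<le> 2 ^ k"
    proof
      assume "N \<le> 2 ^ k"
      then have "T \<turnstile> e" by (rule MP[OF MP[OF nsum_N derivable_nsum_mono] d(2)])
      then show False using e(2) derivable_weaken by blast
    qed
    moreover have "k < 2 ^ k" by (rule less_exp)
    ultimately have N: "Suc k \<le> N" by linarith
    \<comment> \<open>One copy less than needed to cover \<open>b\<close> fits below
      \<open>b\<close>, so the error constant is 1. For \<open>steps b = 0\<close> natural
      subtraction gives 0, and \<open>nsum 0 d\<close> is \<open>Bot\<close>.\<close>
    have "\<exists>j. T \<turnstile> Imp (nsum j d) b \<and> j \<le> steps b \<and> steps b \<le> j + 1" for b
      using nsum_le[of "steps b - 1" b] derivable_Bot[of T b]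
      by (intro exI[of _ "steps b - 1"]) (cases "steps b"; simp add: nsum_0)
    then have approx: "\<bar>real (steps \<phi>) - real N * tval \<phi> point\<bar> \<le> real 1 * real (size \<phi>)" for \<phi>
      by (rule steps_approx_tval)
    have "1 - tval \<phi> point \<le> real (size \<phi>) / real (Suc k)" if "T \<turnstile> \<phi>" for \<phi>
    proof -
      have "real N * (1 - tval \<phi> point) \<le> real (size \<phi>)"
        using approx[of \<phi>] steps_derivable[OF that] by (simp add: algebra_simps)
      then have "1 - tval \<phi> point \<le> real (size \<phi>) / real N"
        using N_pos by (simp add: field_simps)
      also have "\<dots> \<le> real (size \<phi>) / real (Suc k)"
        using N by (intro divide_left_mono) auto
      finally show ?thesis .
    qed
    then show ?thesis using point_in_cube by blast
  qed
  then have "\<forall>k. \<exists>w. w \<in> unit_cube \<and>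
      (\<forall>\<phi>. T \<turnstile> \<phi> \<longrightarrow> 1 - tval \<phi> w \<le> real (size \<phi>) / real (Suc k))" by blast
  from choice[OF this] obtain w where w: "\<And>k. w k \<in> unit_cube"
    "\<And>k \<phi>. T \<turnstile> \<phi> \<Longrightarrow> 1 - tval \<phi> (w k) \<le> real (size \<phi>) / real (Suc k)"
    by blast
  have "unit_cube = cbox (0 :: real ^ 'n) 1"
    by (auto simp: mem_box_cart)
  then have "compact (unit_cube :: (real ^ 'n) set)" by (simp only: compact_cbox)
  moreover have "\<forall>k. w k \<in> unit_cube" using w(1) by (rule allI)
  ultimately obtain l r where l: "l \<in> unit_cube" "strict_mono r" "(w \<circ> r) \<longlonglongrightarrow> l"
    by (rule seq_compactE[OF compact_imp_seq_compact])
  have "tval \<phi> l = 1" if "T \<turnstile> \<phi>" for \<phi>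
  proof (rule antisym)
    have "(\<lambda>k. real (size \<phi>) * inverse (real (Suc k))) \<longlonglongrightarrow> real (size \<phi>) * 0"
      by (intro tendsto_intros LIMSEQ_inverse_real_of_nat)
    then have "(\<lambda>k. real (size \<phi>) / real (Suc k)) \<longlonglongrightarrow> 0"
      by (simp add: divide_inverse)
    then have 1: "(\<lambda>k. real (size \<phi>) / real (Suc (r k))) \<longlonglongrightarrow> 0"
      using LIMSEQ_subseq_LIMSEQ[OF _ l(2)] by (fastforce simp: o_def)
    have 2: "(\<lambda>k. 1 - tval \<phi> (w (r k))) \<longlonglongrightarrow> 1 - tval \<phi> l"
      using continuous_on_tendsto_compose[OF continuous_tval l(3)]
      by (intro tendsto_intros) (simp add: o_def)
    have "1 - tval \<phi> l \<le> 0"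
      by (rule LIMSEQ_le[OF 2 1]) (use w(2)[OF that] in blast)
    then show "1 \<le> tval \<phi> l" by simp
    show "tval \<phi> l \<le> 1" using tval_range[OF l(1)] by blast
  qed
  then show ?thesis using l(1) by blast
qed

lemma exists_model: "\<exists>w\<in>unit_cube. \<forall>\<phi>. T \<turnstile> \<phi> \<longrightarrow> tval \<phi> w = 1"
proof (cases "\<exists>e. \<not> T \<turnstile> Neg e \<and> (\<forall>x. \<not> T \<turnstile> Neg x \<longrightarrow> T \<turnstile> Imp e x)")
  case True
  then obtain e where "\<not> T \<turnstile> Neg e" "\<And>x. \<not> T \<turnstile> Neg x \<Longrightarrow> T \<turnstile> Imp e x" by blast
  then show ?thesis by (rule exists_model_atomic)
next
  case False
  show ?thesis by (rule exists_model_atomless) (use False in blast)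
qed

end

section \<open>Ideals of Lindenbaum algebras\<close>

lemma derivable_sound:
  assumes "T \<turnstile> \<phi>" "w \<in> unit_cube" "\<And>\<theta>. \<theta> \<in> T \<Longrightarrow> tval \<theta> w = 1"
  shows "tval \<phi> w = 1"
  using assms(1)
proof (induction rule: derivable.induct)
  case (MP \<phi> \<psi>)
  then show ?case using tval_range[OF assms(2), of \<psi>] by (simp add: min_def split: if_splits)
next
  case (A1 \<phi> \<psi>)
  then show ?case using tval_range[OF assms(2)] by (simp add: min_def)
next
  case (A2 \<phi> \<psi> \<xi>)
  then show ?case
    using tval_range[OF assms(2), of \<phi>] tval_range[OF assms(2), of \<psi>] tval_range[OF assms(2), of \<xi>]
    by (simp add: min_def)
next
  case (A3 \<phi> \<psi>)
  then show ?case
    using tval_range[OF assms(2), of \<phi>] tval_range[OF assms(2), of \<psi>] by (simp add: min_def)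
qed (auto simp: assms(3) min_def)

abbreviation cls :: "'n form set \<Rightarrow> 'n form \<Rightarrow> 'n form set" where
  "cls T a \<equiv> form_equiv T `` {a}"

lemma cls_eq_iff: "cls T a = cls T b \<longleftrightarrow> T \<turnstile> Imp a b \<and> T \<turnstile> Imp b a"
  using eq_equiv_class_iff[OF equiv_form_equiv] by (simp add: form_equiv_iff)

lemma mem_cls: "b \<in> cls T a \<longleftrightarrow> T \<turnstile> Imp a b \<and> T \<turnstile> Imp b a"
  by (simp add: form_equiv_iff)

lemma cls_eq_top_iff: "cls T a = cls T (Neg Bot) \<longleftrightarrow> T \<turnstile> a"
  unfolding cls_eq_iff
  using derivable_weaken[of T a "Neg Bot"] derivable_weaken[OF derivable_Neg_Bot, of T a]
    MP[OF derivable_Neg_Bot, of T a] by auto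

lemma LIND_zero_cls: "mv_zero (LIND T) = cls T Bot"
  by (rule LIND_zero[OF derivable_Neg_Bot])

lemma derivable_Neg_cong: "cls T a = cls T b \<Longrightarrow> T \<turnstile> Neg a \<longleftrightarrow> T \<turnstile> Neg b"
  unfolding cls_eq_iff using MP[OF _ derivable_contra_rule] by auto

lemma cls_eq_zero_iff: "cls T a = cls T Bot \<longleftrightarrow> T \<turnstile> Neg a"
proof
  assume "T \<turnstile> Neg a"
  then have "T \<turnstile> Imp a Bot" using A4 derivable_weaken MP by blast
  then show "cls T a = cls T Bot" by (simp add: cls_eq_iff derivable_Bot)
qed (use derivable_Neg_cong derivable_Neg_Bot in blast)

lemma cls_cong:
  "cls T a = cls T a' \<Longrightarrow> cls T (Neg a) = cls T (Neg a')"
  "cls T a = cls T a' \<Longrightarrow> cls T b = cls T b' \<Longrightarrow> cls T (Oplus a b) = cls T (Oplus a' b')"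
  using form_equiv_Neg form_equiv_Oplus by (simp_all add: eq_equiv_class_iff[OF equiv_form_equiv])

lemma cls_Neg_Neg: "cls T (Neg (Neg a)) = cls T a"
  by (simp add: cls_eq_iff derivable_dne derivable_dni)

lemma cls_mono: "T \<subseteq> T' \<Longrightarrow> cls T a = cls T b \<Longrightarrow> cls T' a = cls T' b"
  unfolding cls_eq_iff using derivable_mono by blast

lemma derivable_Imp_Oplus: "T \<turnstile> Oplus (Neg a) b \<longleftrightarrow> T \<turnstile> Imp a b"
  unfolding Oplus_def
  using MP[OF _ derivable_Imp_mono[OF derivable_dni derivable_refl], of T a b]
    MP[OF _ derivable_Imp_mono[OF derivable_dne derivable_refl], of T a b] by auto

lemma LIND_le: "mv_le (LIND T) (cls T a) (cls T b) \<longleftrightarrow> T \<turnstile> Imp a b"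
  by (simp add: mv_le_def mv_one_def LIND_zero_cls LIND_neg LIND_plus cls_eq_top_iff
      derivable_Imp_Oplus)

lemma derivable_Neg_Oplus: "T \<turnstile> Neg (Oplus a b) \<longleftrightarrow> T \<turnstile> Neg a \<and> T \<turnstile> Neg b"
proof
  assume "T \<turnstile> Neg (Oplus a b)"
  then show "T \<turnstile> Neg a \<and> T \<turnstile> Neg b"
    using MP[OF _ derivable_contra_rule[OF derivable_Oplus_left]]
      MP[OF _ derivable_contra_rule[OF derivable_Oplus_right]] by auto
next
  assume ab: "T \<turnstile> Neg a \<and> T \<turnstile> Neg b"
  then have "T \<turnstile> Imp (Oplus a b) b" unfolding Oplus_def using derivable_assert MP by blast
  then show "T \<turnstile> Neg (Oplus a b)" using derivable_contra_rule ab MP by blast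
qed

lemma derivable_Neg_Neg: "T \<turnstile> Neg (Neg a) \<longleftrightarrow> T \<turnstile> a"
  using MP[OF _ derivable_dne, of T a] MP[OF _ derivable_dni, of T a] by auto

lemma LIND_dist:
  "mv_dist (LIND T) (cls T a) (cls T b) =
    cls T (Oplus (Neg (Oplus (Neg a) b)) (Neg (Oplus (Neg b) a)))"
  by (simp add: mv_dist_def mv_minus_def LIND_neg LIND_plus)

lemma derivable_Neg_dist:
  "T \<turnstile> Neg (Oplus (Neg (Oplus (Neg a) b)) (Neg (Oplus (Neg b) a))) \<longleftrightarrow> cls T a = cls T b"
  by (simp only: derivable_Neg_Oplus derivable_Neg_Neg derivable_Imp_Oplus cls_eq_iff)

text \<open>Ideals collect refuted formulas and theories derived ones, so both translations between
  them pass through \<open>Neg\<close>.\<close>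

definition theory_ideal :: "'n form set \<Rightarrow> 'n form set \<Rightarrow> 'n form set set" where
  "theory_ideal \<Theta> T = cls \<Theta> ` {a. T \<turnstile> Neg a}"

definition ideal_theory :: "'n form set \<Rightarrow> 'n form set set \<Rightarrow> 'n form set" where
  "ideal_theory \<Theta> J = {a. cls \<Theta> (Neg a) \<in> J}"

lemma mem_theory_ideal:
  assumes "\<Theta> \<subseteq> T"
  shows "cls \<Theta> a \<in> theory_ideal \<Theta> T \<longleftrightarrow> T \<turnstile> Neg a"
proof
  assume "cls \<Theta> a \<in> theory_ideal \<Theta> T"
  then obtain b where b: "cls \<Theta> a = cls \<Theta> b" "T \<turnstile> Neg b"
    unfolding theory_ideal_def by blast
  then show "T \<turnstile> Neg a" using derivable_Neg_cong[OF cls_mono[OF assms b(1)]] by blast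
qed (simp add: theory_ideal_def)

lemma mv_ideal_theory_ideal:
  assumes "\<Theta> \<subseteq> T"
  shows "mv_ideal (LIND \<Theta>) (theory_ideal \<Theta> T)"
proof -
  have "T \<turnstile> Neg b" if "T \<turnstile> Neg a" "\<Theta> \<turnstile> Imp b a" for a b
  proof -
    have "T \<turnstile> Imp b a" using that(2) assms by (rule derivable_mono)
    then show ?thesis by (rule MP[OF that(1) derivable_contra_rule])
  qed
  then show ?thesis
    unfolding mv_ideal_def LIND_carrier LIND_zero_cls
    by (auto simp: theory_ideal_def derivable_Neg_Bot LIND_plus LIND_le derivable_Neg_Oplus
        intro!: imageI)
qed

text \<open>Modus Ponens becomes an inequality: \<open>Neg b\<close> lies below the sum of
  \<open>Neg a\<close> and \<open>Neg (Imp a b)\<close>, and ideals are closed under sums and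
  downwards.\<close>

lemma ideal_theory_closed:
  assumes J: "mv_ideal (LIND \<Theta>) J" and "ideal_theory \<Theta> J \<turnstile> a"
  shows "a \<in> ideal_theory \<Theta> J"
proof -
  have ax: "a \<in> ideal_theory \<Theta> J" if "\<Theta> \<turnstile> a" for a
  proof -
    have "cls \<Theta> (Neg a) = cls \<Theta> Bot"
      unfolding cls_eq_zero_iff using that by (simp only: derivable_Neg_Neg)
    then show ?thesis using J by (simp add: ideal_theory_def mv_ideal_def LIND_zero_cls)
  qed
  show ?thesis using assms(2)
  proof (induction rule: derivable.induct)
    case (MP a b)
    then have "mv_plus (LIND \<Theta>) (cls \<Theta> (Neg a)) (cls \<Theta> (Neg (Imp a b))) \<in> J"
      using J by (simp add: ideal_theory_def mv_ideal_def)
    moreover have "\<Theta> \<turnstile> Imp (Neg b) (Oplus (Neg a) (Neg (Imp a b)))"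
      unfolding Oplus_def
      by (rule derivable_exch_rule[OF derivable_trans[OF derivable_dne
              derivable_trans[OF derivable_assert derivable_contra]]])
    ultimately show ?case
      using J unfolding mv_ideal_def ideal_theory_def LIND_plus LIND_carrier
      by (auto simp: LIND_le)
  qed (auto intro: ax derivable.intros)
qed

lemma subset_ideal_theory:
  assumes "mv_ideal (LIND \<Theta>) J"
  shows "\<Theta> \<subseteq> ideal_theory \<Theta> J"
proof
  fix a assume "a \<in> \<Theta>"
  then have "\<Theta> \<turnstile> Neg (Neg a)" by (simp only: derivable_Neg_Neg derivable.hyp)
  then have "cls \<Theta> (Neg a) = cls \<Theta> Bot" by (simp add: cls_eq_zero_iff)
  then show "a \<in> ideal_theory \<Theta> J"
    using assms by (simp add: ideal_theory_def mv_ideal_def LIND_zero_cls)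
qed

text \<open>The theory of an ideal containing the class of \<open>Neg a\<close> contains
  \<open>a\<close> and all of \<open>\<Theta>\<close>, hence everything derivable from
  \<open>insert a \<Theta>\<close>. Conversely, \<open>insert a \<Theta>\<close> itself yields such
  an ideal.\<close>

lemma principal_ideal_LIND:
  "mv_principal_ideal (LIND \<Theta>) (cls \<Theta> (Neg a)) = theory_ideal \<Theta> (insert a \<Theta>)"
proof
  have "insert a \<Theta> \<turnstile> Neg (Neg a)" by (simp add: derivable_Neg_Neg derivable.hyp)
  then show "mv_principal_ideal (LIND \<Theta>) (cls \<Theta> (Neg a)) \<subseteq> theory_ideal \<Theta> (insert a \<Theta>)"
    unfolding mv_principal_ideal_def
    using mv_ideal_theory_ideal[of \<Theta> "insert a \<Theta>"] mem_theory_ideal[of \<Theta> "insert a \<Theta>"] by blast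
  show "theory_ideal \<Theta> (insert a \<Theta>) \<subseteq> mv_principal_ideal (LIND \<Theta>) (cls \<Theta> (Neg a))"
    unfolding mv_principal_ideal_def theory_ideal_def
  proof (clarsimp simp del: Image_singleton_iff)
    fix b J
    assume b: "insert a \<Theta> \<turnstile> Neg b" and J: "mv_ideal (LIND \<Theta>) J" "cls \<Theta> (Neg a) \<in> J"
    have "ideal_theory \<Theta> J \<turnstile> Neg b"
      using subset_ideal_theory[OF J(1)] J(2)
      by (intro derivable_cut[OF b]) (auto simp: ideal_theory_def intro: derivable.hyp)
    then have "cls \<Theta> (Neg (Neg b)) \<in> J"
      using ideal_theory_closed[OF J(1)] by (simp add: ideal_theory_def)
    then show "cls \<Theta> b \<in> J" by (simp add: cls_Neg_Neg)
  qed
qed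

section \<open>Transfer of semisimplicity along isomorphisms\<close>

locale mv_iso =
  fixes A :: "'a mv" and B :: "'b mv" and f :: "'a \<Rightarrow> 'b"
  assumes mv: "mv_algebra A"
    and bij: "bij_betw f (mv_carrier A) (mv_carrier B)"
    and zero: "f (mv_zero A) = mv_zero B"
    and neg: "x \<in> mv_carrier A \<Longrightarrow> f (mv_neg A x) = mv_neg B (f x)"
    and plus: "x \<in> mv_carrier A \<Longrightarrow> y \<in> mv_carrier A \<Longrightarrow>
      f (mv_plus A x y) = mv_plus B (f x) (f y)"
begin

lemma closed:
  "mv_zero A \<in> mv_carrier A" "x \<in> mv_carrier A \<Longrightarrow> mv_neg A x \<in> mv_carrier A"
  "x \<in> mv_carrier A \<Longrightarrow> y \<in> mv_carrier A \<Longrightarrow> mv_plus A x y \<in> mv_carrier A"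
  using mv unfolding mv_algebra_def by auto

lemma inj: "x \<in> mv_carrier A \<Longrightarrow> y \<in> mv_carrier A \<Longrightarrow> f x = f y \<longleftrightarrow> x = y"
  using bij unfolding bij_betw_def by (meson inj_on_eq_iff)

lemma surj: "mv_carrier B = f ` mv_carrier A"
  using bij by (simp add: bij_betw_def)

lemma le:
  assumes "x \<in> mv_carrier A" "y \<in> mv_carrier A"
  shows "mv_le B (f x) (f y) \<longleftrightarrow> mv_le A x y"
proof -
  have "mv_plus B (mv_neg B (f x)) (f y) = f (mv_plus A (mv_neg A x) y)"
    "mv_one B = f (mv_one A)"
    using assms by (simp_all add: plus neg closed mv_one_def zero[symmetric])
  then show ?thesis unfolding mv_le_def using assms inj by (simp add: closed mv_one_def)
qed

lemma ideal_image_iff: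
  assumes "J \<subseteq> mv_carrier A"
  shows "mv_ideal B (f ` J) \<longleftrightarrow> mv_ideal A J"
proof -
  have mem: "f x \<in> f ` J \<longleftrightarrow> x \<in> J" if "x \<in> mv_carrier A" for x
    using assms that inj by blast
  have "mv_zero B \<in> f ` J \<longleftrightarrow> mv_zero A \<in> J" using mem closed zero by metis
  moreover have "mv_plus B (f x) (f y) \<in> f ` J \<longleftrightarrow> mv_plus A x y \<in> J" if "x \<in> J" "y \<in> J" for x y
    using that assms mem closed plus by (metis subsetD)
  moreover have "f ` J \<subseteq> mv_carrier B" using assms surj by blast
  ultimately show ?thesis
    using assms mem le unfolding mv_ideal_def surj by (auto simp: subset_iff)
qed

lemma maximal_ideal_image_iff:
  assumes "J \<subseteq> mv_carrier A"
  shows "mv_maximal_ideal B (f ` J) \<longleftrightarrow> mv_maximal_ideal A J"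
proof -
  have eq: "f ` I = f ` I' \<longleftrightarrow> I = I'" if "I \<subseteq> mv_carrier A" "I' \<subseteq> mv_carrier A" for I I'
    using that bij by (meson bij_betw_def inj_on_image_eq_iff)
  have sub: "f ` I \<subseteq> f ` I' \<longleftrightarrow> I \<subseteq> I'" if "I \<subseteq> mv_carrier A" "I' \<subseteq> mv_carrier A" for I I'
    using that bij by (meson bij_betw_def inj_on_image_subset_iff)
  have "(\<forall>I. mv_ideal B I \<and> f ` J \<subseteq> I \<and> I \<noteq> mv_carrier B \<longrightarrow> I = f ` J) \<longleftrightarrow>
    (\<forall>I. mv_ideal A I \<and> J \<subseteq> I \<and> I \<noteq> mv_carrier A \<longrightarrow> I = J)" (is "?L \<longleftrightarrow> ?R")
  proof
    assume L: ?L
    show ?R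
    proof (intro allI impI)
      fix I assume I: "mv_ideal A I \<and> J \<subseteq> I \<and> I \<noteq> mv_carrier A"
      then have "I \<subseteq> mv_carrier A" by (simp add: mv_ideal_def)
      then show "I = J" using L I assms eq[of I J] eq[of I "mv_carrier A"] ideal_image_iff[of I] surj
        by (metis image_mono order_refl)
    qed
  next
    assume R: ?R
    show ?L
    proof (intro allI impI)
      fix I assume I: "mv_ideal B I \<and> f ` J \<subseteq> I \<and> I \<noteq> mv_carrier B"
      then have "I \<subseteq> f ` mv_carrier A" by (simp add: mv_ideal_def surj)
      then obtain K where K: "K \<subseteq> mv_carrier A" "I = f ` K" by (auto simp: subset_image_iff)
      then show "I = f ` J" using R I assms sub[of J K] ideal_image_iff[of K] surj by metis
    qed
  qed
  then show ?thesis
    unfolding mv_maximal_ideal_def using ideal_image_iff[OF assms] eq[OF assms order_refl] surj by simp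
qed

text \<open>Every maximal ideal of \<open>B\<close> is the image of one of \<open>A\<close>, so an
  element lying in all maximal ideals of \<open>A\<close> is mapped into all those of
  \<open>B\<close>.\<close>

lemma semisimple_transfer:
  assumes "semisimple B"
  shows "semisimple A"
proof -
  have "x = mv_zero A" if x: "x \<in> mv_carrier A" "\<And>J. mv_maximal_ideal A J \<Longrightarrow> x \<in> J" for x
  proof -
    have "f x \<in> I" if I: "mv_maximal_ideal B I" for I
    proof -
      have "I \<subseteq> f ` mv_carrier A" using I by (simp add: mv_ideal_def mv_maximal_ideal_def surj)
      then obtain K where K: "K \<subseteq> mv_carrier A" "I = f ` K" by (auto simp: subset_image_iff)
      then show ?thesis using I x(2) maximal_ideal_image_iff by blast
    qed
    then have "f x = mv_zero B" using assms x(1) surj unfolding semisimple_def by blast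
    then show ?thesis using inj x(1) closed(1) zero by metis
  qed
  then show ?thesis
    using closed(1) unfolding semisimple_def mv_maximal_ideal_def mv_ideal_def by blast
qed

end

text \<open>An element of the quotient is a set of classes modulo \<open>\<Theta>\<close>. Since
  \<open>T\<close> refutes the distance of \<open>a\<close> and \<open>b\<close> exactly when it
  proves them equivalent, this set is the image of a single class modulo \<open>T\<close>, which
  gives the bijection.\<close>

lemma mv_iso_LIND_quotient:
  assumes "\<Theta> \<subseteq> T"
  shows "mv_iso (LIND T) (mv_quotient (LIND \<Theta>) (theory_ideal \<Theta> T)) ((`) (cls \<Theta>))"
proof -
  let ?C = "mv_cong (LIND \<Theta>) (theory_ideal \<Theta> T)"
  let ?Q = "mv_quotient (LIND \<Theta>) (theory_ideal \<Theta> T)"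
  have cong: "(cls \<Theta> a, cls \<Theta> b) \<in> ?C \<longleftrightarrow> cls T a = cls T b" for a b
    unfolding mv_cong_def
    by (simp add: LIND_dist mem_theory_ideal[OF assms] derivable_Neg_dist LIND_carrier)
  have dom: "?C \<subseteq> range (cls \<Theta>) \<times> range (cls \<Theta>)"
    by (auto simp: mv_cong_def LIND_carrier)
  have mem: "b \<in> cls T a \<longleftrightarrow> cls T a = cls T b" for a b by (simp only: mem_cls cls_eq_iff)
  have img: "?C `` {cls \<Theta> a} = cls \<Theta> ` cls T a" for a
  proof (intro equalityI subsetI)
    fix y assume y: "y \<in> ?C `` {cls \<Theta> a}"
    then obtain b where "y = cls \<Theta> b" using dom by blast
    then show "y \<in> cls \<Theta> ` cls T a" using y cong mem by blast
  next
    fix y assume "y \<in> cls \<Theta> ` cls T a"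
    then show "y \<in> ?C `` {cls \<Theta> a}" using cong mem by blast
  qed
  have carrier: "mv_carrier ?Q = ((`) (cls \<Theta>)) ` mv_carrier (LIND T)"
    by (auto simp: mv_quotient_def quotient_def LIND_carrier img)
  have self: "a \<in> cls T a" for a by (simp only: mem)
  then have ne: "cls T a \<noteq> {}" for a by blast
  have plus: "mv_plus ?Q (cls \<Theta> ` cls T a) (cls \<Theta> ` cls T b) = cls \<Theta> ` cls T (Oplus a b)" for a b
  proof -
    have "?C `` {mv_plus (LIND \<Theta>) (cls \<Theta> a') (cls \<Theta> b')} = cls \<Theta> ` cls T (Oplus a b)"
      if "a' \<in> cls T a" "b' \<in> cls T b" for a' b'
    proof -
      have "cls T (Oplus a b) = cls T (Oplus a' b')" using that unfolding mem by (rule cls_cong)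
      then show ?thesis by (simp only: LIND_plus img)
    qed
    then show ?thesis by (auto simp: mv_quotient_def ne simp del: Image_singleton_iff)
  qed
  have neg: "mv_neg ?Q (cls \<Theta> ` cls T a) = cls \<Theta> ` cls T (Neg a)" for a
  proof -
    have "?C `` {mv_neg (LIND \<Theta>) (cls \<Theta> a')} = cls \<Theta> ` cls T (Neg a)"
      if "a' \<in> cls T a" for a'
    proof -
      have "cls T (Neg a) = cls T (Neg a')" using that unfolding mem by (rule cls_cong)
      then show ?thesis by (simp only: LIND_neg img)
    qed
    then show ?thesis by (auto simp: mv_quotient_def ne simp del: Image_singleton_iff)
  qed
  have zero: "mv_zero ?Q = cls \<Theta> ` cls T Bot"
    by (simp add: mv_quotient_def LIND_zero_cls img del: Image_singleton_iff)
  have "inj_on ((`) (cls \<Theta>)) (mv_carrier (LIND T))"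
  proof (rule inj_onI)
    fix x y
    assume "x \<in> mv_carrier (LIND T)" "y \<in> mv_carrier (LIND T)" and eq: "cls \<Theta> ` x = cls \<Theta> ` y"
    then obtain a b where ab: "x = cls T a" "y = cls T b" by (auto simp: LIND_carrier)
    have "cls \<Theta> a \<in> cls \<Theta> ` cls T b" using eq ab self by blast
    then obtain c where "c \<in> cls T b" "cls \<Theta> a = cls \<Theta> c" by blast
    then show "x = y" unfolding ab mem using cls_mono[OF assms] by metis
  qed
  then show ?thesis
    using carrier
    by unfold_locales
      (auto simp: mv_algebra_LIND bij_betw_def LIND_zero_cls zero LIND_carrier LIND_plus plus
        LIND_neg neg simp del: Image_singleton_iff)
qed

text \<open>If adding \<open>a\<close> did not make everything derivable, the enlarged theory would
  give a proper ideal above \<open>J\<close>, hence \<open>J\<close> itself, and \<open>a\<close>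
  would already belong to the theory of \<open>J\<close>.\<close>

lemma maximal_theory_ideal_theory:
  assumes "mv_maximal_ideal (LIND T) J"
  shows "maximal_theory (ideal_theory T J)"
proof
  let ?S = "ideal_theory T J"
  have J: "mv_ideal (LIND T) J" and J': "J \<noteq> mv_carrier (LIND T)"
    and max: "\<And>I. mv_ideal (LIND T) I \<Longrightarrow> J \<subseteq> I \<Longrightarrow> I \<noteq> mv_carrier (LIND T) \<Longrightarrow> I = J"
    using assms unfolding mv_maximal_ideal_def by blast+
  show "\<not> ?S \<turnstile> Bot"
  proof
    assume "?S \<turnstile> Bot"
    then have "cls T (Neg Bot) \<in> J" using ideal_theory_closed[OF J] by (simp add: ideal_theory_def)
    then have "cls T a \<in> J" for a
      using J derivable_weaken[OF derivable_Neg_Bot, of T a]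
      unfolding mv_ideal_def LIND_carrier LIND_le[symmetric] by blast
    then show False using J J' by (auto simp: mv_ideal_def LIND_carrier)
  qed
  show "insert a ?S \<turnstile> b" if "\<not> ?S \<turnstile> a" for a b
  proof (rule ccontr)
    assume nb: "\<not> insert a ?S \<turnstile> b"
    let ?I = "theory_ideal T (insert a ?S)"
    have TS: "T \<subseteq> insert a ?S" using subset_ideal_theory[OF J] by blast
    have "J \<subseteq> ?I"
    proof
      fix x assume x: "x \<in> J"
      then obtain c where c: "x = cls T c" using J by (auto simp: mv_ideal_def LIND_carrier)
      then have "Neg c \<in> ?S" using x by (simp only: ideal_theory_def mem_Collect_eq cls_Neg_Neg)
      then show "x \<in> ?I" unfolding c mem_theory_ideal[OF TS] by (simp add: derivable.hyp)
    qed
    moreover have "?I \<noteq> mv_carrier (LIND T)"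
    proof
      assume "?I = mv_carrier (LIND T)"
      then have "cls T (Neg b) \<in> ?I" by (simp add: LIND_carrier)
      then show False using nb by (simp only: mem_theory_ideal[OF TS] derivable_Neg_Neg)
    qed
    ultimately have "?I = J" using max mv_ideal_theory_ideal[OF TS] by blast
    moreover have "insert a ?S \<turnstile> Neg (Neg a)" by (simp add: derivable_Neg_Neg derivable.hyp)
    ultimately have "a \<in> ?S" using mem_theory_ideal[OF TS, of "Neg a"] by (simp add: ideal_theory_def)
    then show False using that derivable.hyp by blast
  qed
qed

text \<open>The class of \<open>Neg a\<close> is nonzero but lies in every maximal ideal. The theory
  of such an ideal has a model \<open>w\<close>, and \<open>a\<close> is true there; were
  \<open>a\<close> not derivable from the theory, adding it would be inconsistent although
  \<open>w\<close> satisfies the result.\<close>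

lemma not_semisimple_LIND:
  assumes "T \<Turnstile> a" "\<not> T \<turnstile> a"
  shows "\<not> semisimple (LIND T)"
proof
  assume ss: "semisimple (LIND T)"
  have "cls T (Neg a) \<in> J" if J: "mv_maximal_ideal (LIND T) J" for J
  proof -
    have ideal: "mv_ideal (LIND T) J" using J by (simp add: mv_maximal_ideal_def)
    interpret maximal_theory "ideal_theory T J" by (rule maximal_theory_ideal_theory[OF J])
    obtain w where w: "w \<in> unit_cube" "\<And>b. ideal_theory T J \<turnstile> b \<Longrightarrow> tval b w = 1"
      using exists_model by blast
    have "w \<in> Mod T"
      using w subset_ideal_theory[OF ideal] derivable.hyp unfolding Mod_def by blast
    then have a: "tval a w = 1" using assms(1) by (simp add: entails_def)
    have "ideal_theory T J \<turnstile> a"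
    proof (rule ccontr)
      assume "\<not> ?thesis"
      then have "insert a (ideal_theory T J) \<turnstile> Bot" by (rule maximal)
      then have "tval Bot w = 1"
        by (rule derivable_sound[OF _ w(1)]) (use a w(2) derivable.hyp in blast)
      then show False by (simp add: Bot_def)
    qed
    then show ?thesis using ideal_theory_closed[OF ideal] by (simp add: ideal_theory_def)
  qed
  then have "cls T (Neg a) \<in> {x \<in> mv_carrier (LIND T). \<forall>J. mv_maximal_ideal (LIND T) J \<longrightarrow> x \<in> J}"
    unfolding LIND_carrier mem_Collect_eq by (intro conjI rangeI allI impI)
  then have "cls T (Neg a) = cls T Bot"
    using ss by (simp only: semisimple_def LIND_zero_cls singleton_iff)
  then show False using assms(2) by (simp only: cls_eq_zero_iff derivable_Neg_Neg)
qed

lemma not_strongly_semisimple_LIND: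
  assumes "insert c \<Theta> \<Turnstile> a" "\<not> insert c \<Theta> \<turnstile> a"
  shows "\<not> strongly_semisimple (LIND \<Theta>)"
proof
  assume "strongly_semisimple (LIND \<Theta>)"
  then have "semisimple (mv_quotient (LIND \<Theta>) (theory_ideal \<Theta> (insert c \<Theta>)))"
    unfolding strongly_semisimple_def LIND_carrier by (metis principal_ideal_LIND rangeI)
  then have "semisimple (LIND (insert c \<Theta>))"
    by (rule mv_iso.semisimple_transfer[OF mv_iso_LIND_quotient[OF subset_insertI]])
  then show False using not_semisimple_LIND[OF assms] by blast
qed

section \<open>Truth functions along tangent directions\<close>

text \<open>Only the truncation in an implication needs care; all else is closed under the linear
  operations. The expansion holds on a full neighbourhood of \<open>v\<close>, including points
  outside the cube.\<close>

lemma tval_locally_conical: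
  fixes v :: "real ^ 'n::finite"
  shows "\<exists>g. continuous_on UNIV g \<and> (\<forall>h. \<forall>t\<ge>0. g (t *\<^sub>R h) = t * g h) \<and>
    (\<forall>\<^sub>F h in nhds 0. tval \<phi> (v + h) = tval \<phi> v + g h)"
proof (induction \<phi>)
  case (Var i)
  show ?case by (rule exI[of _ "\<lambda>h. h $ i"]) (auto intro!: continuous_intros)
next
  case (Neg \<phi>)
  then obtain g where "continuous_on UNIV g" "\<forall>h. \<forall>t\<ge>0. g (t *\<^sub>R h) = t * g h"
    "\<forall>\<^sub>F h in nhds 0. tval \<phi> (v + h) = tval \<phi> v + g h" by blast
  then show ?case
    by (intro exI[of _ "\<lambda>h. - g h"]) (auto intro!: continuous_intros elim: eventually_mono)
next
  case (Imp \<phi> \<psi>)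
  then obtain g k where g: "continuous_on UNIV g" "\<forall>h. \<forall>t\<ge>0. g (t *\<^sub>R h) = t * g h"
    "\<forall>\<^sub>F h in nhds 0. tval \<phi> (v + h) = tval \<phi> v + g h"
    and k: "continuous_on UNIV k" "\<forall>h. \<forall>t\<ge>0. k (t *\<^sub>R h) = t * k h"
    "\<forall>\<^sub>F h in nhds 0. tval \<psi> (v + h) = tval \<psi> v + k h" by blast
  define c where "c = 1 - tval \<phi> v + tval \<psi> v"
  define f where "f h = k h - g h" for h
  have f: "continuous_on UNIV f" "\<forall>h. \<forall>t\<ge>0. f (t *\<^sub>R h) = t * f h"
    using g k by (auto simp: f_def algebra_simps intro!: continuous_intros)
  have eq: "\<forall>\<^sub>F h in nhds 0. tval (Imp \<phi> \<psi>) (v + h) = min 1 (c + f h)"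
    using g(3) k(3) by eventually_elim (simp add: c_def f_def algebra_simps)
  have "f 0 = 0" using f(2)[rule_format, of 0 0] by simp
  moreover have "(f \<longlongrightarrow> f 0) (nhds 0)"
    using f(1) by (simp add: continuous_on_eq_continuous_at isCont_def tendsto_at_iff_tendsto_nhds)
  ultimately have lim: "((\<lambda>h. c + f h) \<longlongrightarrow> c) (nhds 0)"
    using tendsto_add[OF tendsto_const, of f 0 "nhds 0" c] by simp
  have v: "tval (Imp \<phi> \<psi>) v = min 1 c" by (simp add: c_def)
  \<comment> \<open>\<open>c\<close> is the untruncated value at \<open>v\<close>. Below 1 no
    truncation occurs nearby, above 1 the function is locally constant, and at 1 the part
    \<open>min 0 (f h)\<close> survives.\<close>
  consider "c < 1" | "c = 1" | "c > 1" by linarith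
  then show ?case
  proof cases
    case 1
    then have "\<forall>\<^sub>F h in nhds 0. c + f h < 1" using lim by (rule order_tendstoD(2)[rotated])
    with eq have "\<forall>\<^sub>F h in nhds 0. tval (Imp \<phi> \<psi>) (v + h) = tval (Imp \<phi> \<psi>) v + f h"
      unfolding v by eventually_elim (use 1 in simp)
    then show ?thesis using f by blast
  next
    case 2
    have "\<forall>\<^sub>F h in nhds 0. tval (Imp \<phi> \<psi>) (v + h) = tval (Imp \<phi> \<psi>) v + min 0 (f h)"
      unfolding v using eq by eventually_elim (use 2 in simp)
    moreover have "continuous_on UNIV (\<lambda>h. min 0 (f h))" using f(1) by (intro continuous_intros)
    moreover have "\<forall>h. \<forall>t\<ge>0. min 0 (f (t *\<^sub>R h)) = t * min 0 (f h)"
      using f(2) by (auto simp: min_def mult_le_0_iff zero_le_mult_iff)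
    ultimately show ?thesis by blast
  next
    case 3
    then have "\<forall>\<^sub>F h in nhds 0. 1 < c + f h" using lim by (rule order_tendstoD(1)[rotated])
    with eq have "\<forall>\<^sub>F h in nhds 0. tval (Imp \<phi> \<psi>) (v + h) = tval (Imp \<phi> \<psi>) v + 0"
      unfolding v by eventually_elim (use 3 in simp)
    then show ?thesis by (intro exI[of _ "\<lambda>_. 0"]) auto
  qed
qed

text \<open>At the approximating points of \<open>X\<close> near \<open>v\<close> the increment
  \<open>g\<close> vanishes. Homogeneity allows these displacements to be normalised, so
  \<open>g u = 0\<close> by continuity, and homogeneity again gives 0 along the whole ray.\<close>

lemma tval_eq_1_along_tangent:
  fixes v :: "real ^ 'n::finite"
  assumes "BS_tangent X v u" "\<And>x. x \<in> X \<Longrightarrow> tval \<phi> x = 1"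
  shows "\<exists>\<delta>>0. \<forall>s. 0 \<le> s \<and> s \<le> \<delta> \<longrightarrow> tval \<phi> (v + s *\<^sub>R u) = 1"
proof -
  obtain x where x: "\<And>i. x i \<in> X" "\<And>i. x i \<noteq> v" "x \<longlonglongrightarrow> v"
    and dir: "(\<lambda>i. (1 / norm (x i - v)) *\<^sub>R (x i - v)) \<longlonglongrightarrow> u" and u: "norm u = 1"
    using assms(1) unfolding BS_tangent_def by blast
  obtain g where g: "continuous_on UNIV g" "\<And>h t. t \<ge> 0 \<Longrightarrow> g (t *\<^sub>R h) = t * g h"
    and ev: "\<forall>\<^sub>F h in nhds 0. tval \<phi> (v + h) = tval \<phi> v + g h"
    using tval_locally_conical[of \<phi> v] by blast
  have "isCont (tval \<phi>) v"
    using continuous_tval[of \<phi>] by (simp add: continuous_on_eq_continuous_at)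
  then have "(\<lambda>i. tval \<phi> (x i)) \<longlonglongrightarrow> tval \<phi> v" using x(3) isCont_tendsto_compose by blast
  then have v: "tval \<phi> v = 1" using assms(2) x(1) by (simp add: LIMSEQ_const_iff)
  have "(\<lambda>i. x i - v) \<longlonglongrightarrow> 0" using x(3) by (simp add: LIM_zero)
  then have "\<forall>\<^sub>F i in sequentially. tval \<phi> (v + (x i - v)) = tval \<phi> v + g (x i - v)"
    using ev unfolding filterlim_iff by blast
  then have "\<forall>\<^sub>F i in sequentially. g ((1 / norm (x i - v)) *\<^sub>R (x i - v)) = 0"
    by eventually_elim (simp add: g(2) v assms(2) x(1))
  moreover have "(\<lambda>i. g ((1 / norm (x i - v)) *\<^sub>R (x i - v))) \<longlonglongrightarrow> g u"
    using g(1) dir by (auto intro: continuous_on_tendsto_compose)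
  ultimately have "(\<lambda>i. 0) \<longlonglongrightarrow> g u" using tendsto_cong by fastforce
  then have gu: "g u = 0" by (simp add: LIMSEQ_const_iff)
  obtain \<epsilon> where "\<epsilon> > 0" and \<epsilon>: "\<And>h. norm h < \<epsilon> \<Longrightarrow> tval \<phi> (v + h) = tval \<phi> v + g h"
    using ev unfolding eventually_nhds_metric dist_norm by auto
  \<comment> \<open>Halving turns the open ball of validity into a closed parameter
    interval.\<close>
  have "tval \<phi> (v + s *\<^sub>R u) = 1" if "0 \<le> s" "s \<le> \<epsilon> / 2" for s
    using that \<open>\<epsilon> > 0\<close> \<epsilon>[of "s *\<^sub>R u"] u v g(2) gu by auto
  then show ?thesis using \<open>\<epsilon> > 0\<close> by (intro exI[of _ "\<epsilon> / 2"]) auto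
qed

text \<open>The inequalities defining the cube are one-sets of formulas even outside the cube, so
  the previous lemma applies to them.\<close>

lemma tangent_in_cube:
  fixes v :: "real ^ 'n::finite"
  assumes "BS_tangent X v u" "X \<subseteq> unit_cube"
  shows "\<exists>\<delta>>0. \<forall>s. 0 \<le> s \<and> s \<le> \<delta> \<longrightarrow> v + s *\<^sub>R u \<in> unit_cube"
proof -
  \<comment> \<open>\<open>Imp (Var i) (Var i)\<close> has value 1 everywhere, so the two values at
    \<open>x\<close> are \<open>min 1 (1 + x $ i)\<close> and
    \<open>min 1 (2 - x $ i)\<close>.\<close>
  define \<phi> where "\<phi> i = Imp (Neg (Imp (Var i) (Var i))) (Var i)" for i :: 'n
  define \<psi> where "\<psi> i = Imp (Var i) (Imp (Var i) (Var i))" for i :: 'n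
  have \<phi>: "tval (\<phi> i) x = 1 \<longleftrightarrow> 0 \<le> x $ i" and \<psi>: "tval (\<psi> i) x = 1 \<longleftrightarrow> x $ i \<le> 1" for i x
    by (auto simp: \<phi>_def \<psi>_def min_def)
  have "\<exists>\<delta>>0. \<forall>s. 0 \<le> s \<and> s \<le> \<delta> \<longrightarrow> tval (\<phi> i) (v + s *\<^sub>R u) = 1" for i
    using assms \<phi> by (intro tval_eq_1_along_tangent) auto
  then obtain \<delta> where \<delta>: "\<And>i. \<delta> i > 0"
    "\<And>i s. 0 \<le> s \<Longrightarrow> s \<le> \<delta> i \<Longrightarrow> tval (\<phi> i) (v + s *\<^sub>R u) = 1" by metis
  have "\<exists>\<delta>>0. \<forall>s. 0 \<le> s \<and> s \<le> \<delta> \<longrightarrow> tval (\<psi> i) (v + s *\<^sub>R u) = 1" for i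
    using assms \<psi> by (intro tval_eq_1_along_tangent) auto
  then obtain \<epsilon> where \<epsilon>: "\<And>i. \<epsilon> i > 0"
    "\<And>i s. 0 \<le> s \<Longrightarrow> s \<le> \<epsilon> i \<Longrightarrow> tval (\<psi> i) (v + s *\<^sub>R u) = 1" by metis
  define m where "m = Min (range \<delta> \<union> range \<epsilon>)"
  have "m > 0" unfolding m_def using \<delta>(1) \<epsilon>(1) by (subst Min_gr_iff) auto
  moreover have "m \<le> \<delta> i" "m \<le> \<epsilon> i" for i unfolding m_def by (auto intro!: Min_le)
  ultimately show ?thesis
    using \<delta>(2) \<epsilon>(2) unfolding \<phi> \<psi>
    by (intro exI[of _ m]) (auto, (meson order_trans)+)
qed

section \<open>Differential valuations given by a point and one direction\<close>

lemma diff_simplex_pair: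
  "diff_simplex [v, u] m = (\<lambda>s. v + s *\<^sub>R u) ` {0..1 / real m}"
proof -
  have "(\<lambda>k. [v, u] ! 0 + (\<Sum>j = 1..k. (1 / real m ^ j) *\<^sub>R [v, u] ! j)) ` {..<length [v, u]}
      = {v, v + (1 / real m) *\<^sub>R u}"
    by (auto simp: lessThan_Suc numeral_2_eq_2)
  then have "diff_simplex [v, u] m = closed_segment v (v + (1 / real m) *\<^sub>R u)"
    by (simp only: diff_simplex_def segment_convex_hull)
  also have "\<dots> = (\<lambda>s. v + s *\<^sub>R u) ` {0..1 / real m}"
  proof (intro equalityI subsetI)
    fix x assume "x \<in> closed_segment v (v + (1 / real m) *\<^sub>R u)"
    then obtain t where t: "0 \<le> t" "t \<le> 1" "x = v + (t / real m) *\<^sub>R u"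
      by (auto simp: in_segment algebra_simps)
    then show "x \<in> (\<lambda>s. v + s *\<^sub>R u) ` {0..1 / real m}"
      by (intro image_eqI[of _ _ "t / real m"]) (auto simp: divide_right_mono)
  next
    fix x assume "x \<in> (\<lambda>s. v + s *\<^sub>R u) ` {0..1 / real m}"
    then obtain s where s: "0 \<le> s" "s \<le> 1 / real m" "x = v + s *\<^sub>R u" by auto
    \<comment> \<open>For \<open>m = 0\<close> the convention \<open>1 / 0 = 0\<close> makes both
      sets the single point \<open>v\<close>.\<close>
    then show "x \<in> closed_segment v (v + (1 / real m) *\<^sub>R u)"
      unfolding in_segment
      by (intro exI[of _ "s * real m"]) (cases "m = 0"; auto simp: field_simps)
  qed
  finally show ?thesis .
qed

lemma diff_valuation_pair:
  fixes v :: "real ^ 'n::finite"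
  assumes "norm u = 1" "\<delta> > 0" "\<And>s. 0 \<le> s \<Longrightarrow> s \<le> \<delta> \<Longrightarrow> v + s *\<^sub>R u \<in> unit_cube"
  shows "diff_valuation [v, u]"
proof -
  have "\<forall>\<^sub>F m in sequentially. 1 / real m < \<delta>"
    using order_tendstoD(2)[OF lim_1_over_n assms(2)] by (simp add: divide_inverse)
  then have "\<forall>\<^sub>F m in sequentially. diff_simplex [v, u] m \<subseteq> unit_cube"
  proof eventually_elim
    case (elim m)
    show ?case unfolding diff_simplex_pair using elim assms(3) by fastforce
  qed
  \<comment> \<open>At least one variable exists, so a list with two entries is not too
    long.\<close>
  moreover have "0 < CARD('n)" by (simp add: card_gt_0_iff)
  ultimately show ?thesis
    using assms(1) by (auto simp: diff_valuation_def nth_Cons' split: if_splits)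
qed

lemma diff_sat_pair_iff:
  fixes v :: "real ^ 'n::finite"
  assumes "\<delta> > 0" "\<And>s. 0 \<le> s \<Longrightarrow> s \<le> \<delta> \<Longrightarrow> v + s *\<^sub>R u \<in> unit_cube"
  shows "diff_sat [v, u] \<psi> \<longleftrightarrow> (\<exists>\<epsilon>>0. \<forall>s. 0 \<le> s \<and> s \<le> \<epsilon> \<longrightarrow> tval \<psi> (v + s *\<^sub>R u) = 1)"
proof
  assume "diff_sat [v, u] \<psi>"
  then obtain m where m: "m \<ge> 1" "\<And>x. x \<in> diff_simplex [v, u] m \<Longrightarrow> tval \<psi> x = 1"
    unfolding diff_sat_def by blast
  then show "\<exists>\<epsilon>>0. \<forall>s. 0 \<le> s \<and> s \<le> \<epsilon> \<longrightarrow> tval \<psi> (v + s *\<^sub>R u) = 1"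
    by (intro exI[of _ "1 / real m"]) (auto intro!: m(2) image_eqI simp: diff_simplex_pair)
next
  assume "\<exists>\<epsilon>>0. \<forall>s. 0 \<le> s \<and> s \<le> \<epsilon> \<longrightarrow> tval \<psi> (v + s *\<^sub>R u) = 1"
  then obtain \<epsilon> where \<epsilon>: "\<epsilon> > 0" "\<And>s. 0 \<le> s \<Longrightarrow> s \<le> \<epsilon> \<Longrightarrow> tval \<psi> (v + s *\<^sub>R u) = 1" by blast
  obtain m where m: "inverse (real (Suc m)) < min \<delta> \<epsilon>"
    using reals_Archimedean[of "min \<delta> \<epsilon>"] assms(1) \<epsilon>(1) by auto
  have "0 \<le> s \<and> s \<le> \<delta> \<and> s \<le> \<epsilon>" if "s \<in> {0..1 / real (Suc m)}" for s
    using that m by (auto simp: inverse_eq_divide)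
  then show "diff_sat [v, u] \<psi>"
    unfolding diff_sat_def diff_simplex_pair
    using assms(2) \<epsilon>(2) by (intro exI[of _ "Suc m"] conjI) auto
qed

lemma has_dir_deriv_local:
  assumes "\<epsilon> > 0" "\<And>s. 0 \<le> s \<Longrightarrow> s \<le> \<epsilon> \<Longrightarrow> f (v + s *\<^sub>R u) = a + s * D"
  shows "has_dir_deriv f v u D"
proof -
  have "((\<lambda>s. a + s * D) has_real_derivative D) (at_right 0)"
    by (auto intro!: derivative_eq_intros)
  moreover have "f v = a" using assms(2)[of 0] assms(1) by simp
  moreover have "\<forall>\<^sub>F s in nhds (0::real). s < \<epsilon>"
    using assms(1) by (intro order_tendstoD(2)[OF filterlim_ident])
  ultimately show ?thesis
    unfolding has_dir_deriv_def
    by (subst has_field_derivative_cong_eventually[where g="\<lambda>s. a + s * D"])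
      (use assms in \<open>auto simp: eventually_at_filter elim!: eventually_mono\<close>)
qed

lemma has_dir_deriv_unique: "has_dir_deriv f v u D \<Longrightarrow> has_dir_deriv f v u E \<Longrightarrow> D = E"
  unfolding has_dir_deriv_def has_field_derivative_iff
  by (rule tendsto_unique) (auto simp: trivial_limit_at_right_real)

section \<open>Representable functions\<close>

text \<open>For \<open>x $ i\<close> in the unit interval, the clamp of \<open>F + x $ i\<close> is
  the strong conjunction of the clamp of \<open>F + 1\<close> with the truncated sum of
  \<open>x $ i\<close> and the clamp of \<open>F\<close>. This builds up the coefficients by
  induction on the sum of their absolute values.\<close>

lemma clamp_affine_representable:
  fixes a :: "'n::finite \<Rightarrow> int" and b :: int
  shows "\<exists>\<phi>. \<forall>x\<in>unit_cube. tval \<phi> x =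
    max 0 (min 1 ((\<Sum>i\<in>UNIV. real_of_int (a i) * x $ i) + real_of_int b))"
proof (induction "nat (\<Sum>i\<in>UNIV. \<bar>a i\<bar>)" arbitrary: a b rule: less_induct)
  case less
  define F where "F a b x = (\<Sum>i\<in>UNIV. real_of_int (a i) * x $ i) + real_of_int b"
    for a :: "'n \<Rightarrow> int" and b and x :: "real ^ 'n"
  define rep where "rep a b \<longleftrightarrow> (\<exists>\<phi>. \<forall>x\<in>unit_cube. tval \<phi> x = max 0 (min 1 (F a b x)))" for a b
  have IH: "rep a' b'" if "(\<Sum>i\<in>UNIV. \<bar>a' i\<bar>) < (\<Sum>i\<in>UNIV. \<bar>a i\<bar>)" for a' b'
  proof -
    have "nat (\<Sum>i\<in>UNIV. \<bar>a' i\<bar>) < nat (\<Sum>i\<in>UNIV. \<bar>a i\<bar>)"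
      using that by (subst nat_less_eq_zless) (auto intro: sum_nonneg)
    then show ?thesis unfolding rep_def F_def by (rule less)
  qed
  have step: "rep (a'(i := a' i + 1)) b'" if r: "rep a' b'" "rep a' (b' + 1)" for a' b' i
  proof -
    obtain \<phi> \<psi> where \<phi>: "\<And>x. x \<in> unit_cube \<Longrightarrow> tval \<phi> x = max 0 (min 1 (F a' b' x))"
      and \<psi>: "\<And>x. x \<in> unit_cube \<Longrightarrow> tval \<psi> x = max 0 (min 1 (F a' (b' + 1) x))"
      using r unfolding rep_def by blast
    have F1: "F (a'(i := a' i + 1)) b' x = F a' b' x + x $ i" for x
    proof -
      have "(\<Sum>j\<in>UNIV. real_of_int ((a'(i := a' i + 1)) j) * x $ j)
          = (\<Sum>j\<in>UNIV. real_of_int (a' j) * x $ j + (if j = i then x $ j else 0))"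
        by (intro sum.cong) (auto simp: algebra_simps)
      then show ?thesis by (simp add: F_def sum.distrib)
    qed
    have F2: "F a' (b' + 1) x = F a' b' x + 1" for x by (simp add: F_def)
    have "tval (Odot (Oplus \<phi> (Var i)) \<psi>) x = max 0 (min 1 (F (a'(i := a' i + 1)) b' x))"
      if "x \<in> unit_cube" for x
    proof -
      have "0 \<le> x $ i" "x $ i \<le> 1" using that by auto
      then show ?thesis
        by (simp add: Odot_def tval_Oplus \<phi>[OF that] \<psi>[OF that] F1 F2 min_def max_def)
    qed
    then show ?thesis unfolding rep_def by blast
  qed
  \<comment> \<open>Clamping commutes with the reflection of \<open>y\<close> to
    \<open>1 - y\<close>, so negation flips the sign of all coefficients.\<close>
  have neg: "rep a' b'" if r: "rep (\<lambda>i. - a' i) (1 - b')" for a' b'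
  proof -
    obtain \<phi> where \<phi>: "\<And>x. x \<in> unit_cube \<Longrightarrow> tval \<phi> x = max 0 (min 1 (F (\<lambda>i. - a' i) (1 - b') x))"
      using r unfolding rep_def by blast
    have "F (\<lambda>i. - a' i) (1 - b') x = 1 - F a' b' x" for x by (simp add: F_def sum_negf)
    then have "tval (Neg \<phi>) x = max 0 (min 1 (F a' b' x))" if "x \<in> unit_cube" for x
      using \<phi>[OF that] by (simp add: min_def max_def)
    then show ?thesis unfolding rep_def by blast
  qed
  have pos: "rep a' b'"
    if "a' i > 0" "(\<Sum>i\<in>UNIV. \<bar>a' i\<bar>) = (\<Sum>i\<in>UNIV. \<bar>a i\<bar>)" for a' b' i
  proof -
    let ?a = "a'(i := a' i - 1)"
    have "(\<Sum>j\<in>UNIV. \<bar>?a j\<bar>) < (\<Sum>j\<in>UNIV. \<bar>a' j\<bar>)"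
      using that(1) by (intro sum_strict_mono_ex1) auto
    then have "rep (?a(i := ?a i + 1)) b'" using that(2) by (intro step IH) auto
    then show ?thesis by simp
  qed
  consider "\<forall>i. a i = 0" | i where "a i > 0" | i where "a i < 0" by (meson linorder_neqE)
  then have "rep a b"
  proof cases
    case 1
    have "tval Bot x = 0" "tval (Neg Bot) x = 1" for x :: "real ^ 'n" by (simp_all add: Bot_def)
    moreover have "F a b x = real_of_int b" for x using 1 by (simp add: F_def)
    moreover have "max 0 (min 1 (real_of_int b)) = (if b \<le> 0 then 0 else 1)" by (auto simp: min_def max_def)
    ultimately show ?thesis unfolding rep_def by (metis (full_types))
  next
    case 2
    then show ?thesis by (rule pos) simp
  next
    case 3
    show ?thesis by (rule neg, rule pos[of _ i]) (use 3 in simp_all)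
  qed
  then show ?case by (simp add: rep_def F_def)
qed

lemma rational_common_denominator:
  assumes "finite S" "S \<subseteq> (\<rat> :: real set)"
  shows "\<exists>d::int. d > 0 \<and> (\<forall>q\<in>S. real_of_int d * q \<in> \<int>)"
  using assms
proof (induction rule: finite_induct)
  case empty
  show ?case by (rule exI[of _ 1]) simp
next
  case (insert q S)
  then obtain d :: int where d: "d > 0" "\<forall>q\<in>S. real_of_int d * q \<in> \<int>" by auto
  obtain m n :: int where mn: "n > 0" "q = real_of_int m / real_of_int n"
    using insert.prems Rats_cases' by (metis insert_subset)
  have "real_of_int (d * n) * q = real_of_int (d * m)" using mn by simp
  then have "real_of_int (d * n) * q \<in> \<int>" by (metis Ints_of_int)
  moreover have "real_of_int (d * n) * p \<in> \<int>" if "p \<in> S" for p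
    using Ints_mult[OF Ints_of_int[of n] d(2)[rule_format, OF that]] by (simp add: ac_simps)
  ultimately have "\<forall>p\<in>insert q S. real_of_int (d * n) * p \<in> \<int>" by blast
  then show ?case using d(1) mn(1) by (intro exI[of _ "d * n"]) auto
qed

text \<open>Multiplying by a common denominator \<open>d\<close> reduces to integer coefficients.
  The negated clamp is 1 exactly where the affine function is at most 0, which serves for segments,
  and falls off linearly just beyond, which serves for \<open>lam\<close>.\<close>

lemma rational_affine_representable:
  fixes a :: "real ^ 'n::finite"
  assumes "rational_point a" "b \<in> \<rat>"
  shows "\<exists>\<phi> d. d > 0 \<and> (\<forall>x\<in>unit_cube. tval \<phi> x = 1 - max 0 (min 1 (d * (a \<bullet> x + b))))"
proof -
  obtain d :: int where d: "d > 0" "\<forall>q\<in>insert b (range (($) a)). real_of_int d * q \<in> \<int>"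
    using rational_common_denominator[of "insert b (range (($) a))"] assms
    by (auto simp: rational_point_def)
  have "\<forall>i. \<exists>m::int. real_of_int d * a $ i = real_of_int m" using d(2) by (auto simp: Ints_def)
  then obtain A :: "'n \<Rightarrow> int" where A: "\<And>i. real_of_int d * a $ i = real_of_int (A i)" by metis
  obtain B :: int where B: "real_of_int d * b = real_of_int B" using d(2) by (auto simp: Ints_def)
  obtain \<phi> where \<phi>: "\<And>x. x \<in> unit_cube \<Longrightarrow> tval \<phi> x =
      max 0 (min 1 ((\<Sum>i\<in>UNIV. real_of_int (A i) * x $ i) + real_of_int B))"
    using clamp_affine_representable by blast
  have "(\<Sum>i\<in>UNIV. real_of_int (A i) * x $ i) + real_of_int B = real_of_int d * (a \<bullet> x + b)" for x
    by (simp add: A[symmetric] B[symmetric] inner_vec_def sum_distrib_left algebra_simps)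
  then have "\<forall>x\<in>unit_cube. tval (Neg \<phi>) x = 1 - max 0 (min 1 (real_of_int d * (a \<bullet> x + b)))"
    using \<phi> by simp
  then show ?thesis using d(1) of_int_0_less_iff by blast
qed

lemma rational_halfspace_representable:
  fixes a :: "real ^ 'n::finite"
  assumes "rational_point a" "b \<in> \<rat>"
  shows "\<exists>\<phi>. \<forall>x\<in>unit_cube. tval \<phi> x = 1 \<longleftrightarrow> a \<bullet> x + b \<le> 0"
proof -
  obtain \<phi> and d :: real where d: "d > 0"
    and \<phi>: "\<forall>x\<in>unit_cube. tval \<phi> x = 1 - max 0 (min 1 (d * (a \<bullet> x + b)))"
    using rational_affine_representable[OF assms] by blast
  have "max 0 (min 1 (d * y)) = 0 \<longleftrightarrow> y \<le> 0" for y
    using d mult_le_0_iff[of d y] by (auto simp: max_def min_def)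
  then have "\<forall>x\<in>unit_cube. tval \<phi> x = 1 \<longleftrightarrow> a \<bullet> x + b \<le> 0"
    using \<phi> by simp
  then show ?thesis ..
qed

lemma finite_conjunction_representable:
  assumes "finite I" "\<And>i. i \<in> I \<Longrightarrow> \<exists>\<phi>. \<forall>x\<in>unit_cube. tval \<phi> x = 1 \<longleftrightarrow> P i x"
  shows "\<exists>\<phi>. \<forall>x\<in>unit_cube. tval \<phi> x = 1 \<longleftrightarrow> (\<forall>i\<in>I. P i (x :: real ^ 'n::finite))"
  using assms
proof (induction rule: finite_induct)
  case empty
  show ?case by (rule exI[of _ "Neg Bot"]) (simp add: Bot_def)
next
  case (insert i I)
  then obtain \<phi> \<psi> where \<phi>: "\<forall>x\<in>unit_cube. tval \<phi> x = 1 \<longleftrightarrow> P i x"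
    and \<psi>: "\<forall>x\<in>unit_cube. tval \<psi> x = 1 \<longleftrightarrow> (\<forall>i\<in>I. P i x)" by blast
  have "tval (Odot \<phi> \<psi>) x = 1 \<longleftrightarrow> tval \<phi> x = 1 \<and> tval \<psi> x = 1" if "x \<in> unit_cube" for x
    using tval_range[OF that, of \<phi>] tval_range[OF that, of \<psi>] by (auto simp: Odot_def min_def)
  then show ?case using \<phi> \<psi> by (intro exI[of _ "Odot \<phi> \<psi>"]) simp
qed

lemma rational_segment_representable:
  fixes v w :: "real ^ 'n::finite"
  assumes "rational_point v" "rational_point w" "w \<noteq> 0"
  shows "\<exists>\<phi>. \<forall>x\<in>unit_cube. tval \<phi> x = 1 \<longleftrightarrow> (\<exists>t\<in>{0..1}. x = v + t *\<^sub>R w)"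
proof -
  \<comment> \<open>A coordinate in which \<open>w\<close> moves serves as parameter:
    \<open>f x\<close> is the only \<open>t\<close> that can occur for a point \<open>x\<close> of
    the line.\<close>
  obtain k where k: "w $ k \<noteq> 0" using assms(3) by (auto simp: vec_eq_iff)
  define f where "f = (\<lambda>x. (x $ k - v $ k) / w $ k)"
  have f: "f = (\<lambda>x. (1 / w $ k) * (axis k 1 \<bullet> x) - v $ k / w $ k)"
    by (simp add: f_def inner_axis inner_commute diff_divide_distrib fun_eq_iff)
  text \<open>The halfspaces cutting out the segment: \<open>f \<ge> 0\<close>, \<open>f \<le> 1\<close> and, for each coordinate, two
    inequalities expressing \<open>x $ j = v $ j + f x * w $ j\<close>.\<close>
  define e where "e j = axis j 1 - (w $ j / w $ k) *\<^sub>R (axis k 1 :: real ^ 'n)" for j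
  have e: "e j \<bullet> x - e j \<bullet> v = x $ j - (v $ j + f x * w $ j)" for j x
    by (simp add: e_def f_def inner_diff_left inner_axis inner_commute[of "axis _ _"] algebra_simps
        diff_divide_distrib)
  have rat_e: "rational_point (e j)" "e j \<bullet> v \<in> \<rat>" for j
  proof -
    show r: "rational_point (e j)"
      using assms(2) by (auto simp: rational_point_def e_def axis_def)
    show "e j \<bullet> v \<in> \<rat>"
      using r assms(1) by (auto simp: inner_vec_def rational_point_def intro!: Rats_sum)
  qed
  define H where "H = {((1 / w $ k) *\<^sub>R axis k 1, - (v $ k / w $ k) - 1),
      (- ((1 / w $ k) *\<^sub>R axis k 1), v $ k / w $ k)} \<union>
    range (\<lambda>j. (e j, - (e j \<bullet> v))) \<union> range (\<lambda>j. (- e j, e j \<bullet> v))"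
  have "finite H" by (simp add: H_def)
  moreover have "\<exists>\<phi>. \<forall>x\<in>unit_cube. tval \<phi> x = 1 \<longleftrightarrow> fst h \<bullet> x + snd h \<le> 0" if "h \<in> H" for h
  proof (rule rational_halfspace_representable)
    have "rational_point (- a)" if "rational_point a" for a :: "real ^ 'n"
      using that by (simp add: rational_point_def)
    moreover have "rational_point ((1 / w $ k) *\<^sub>R axis k 1)"
      using assms(2) by (auto simp: rational_point_def axis_def)
    ultimately show "rational_point (fst h)" using that rat_e by (auto simp: H_def)
    have "v $ k / w $ k \<in> \<rat>" using assms by (simp add: rational_point_def)
    then show "snd h \<in> \<rat>" using that rat_e by (auto simp: H_def)
  qed
  ultimately obtain \<phi> where \<phi>: "\<forall>x\<in>unit_cube. tval \<phi> x = 1 \<longleftrightarrow> (\<forall>h\<in>H. fst h \<bullet> x + snd h \<le> 0)"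
    using finite_conjunction_representable[of H "\<lambda>h x. fst h \<bullet> x + snd h \<le> 0"] by blast
  have "(\<forall>h\<in>H. fst h \<bullet> x + snd h \<le> 0) \<longleftrightarrow> (\<exists>t\<in>{0..1}. x = v + t *\<^sub>R w)" for x
  proof -
    have "(\<forall>h\<in>H. fst h \<bullet> x + snd h \<le> 0) \<longleftrightarrow> f x \<le> 1 \<and> 0 \<le> f x \<and> (\<forall>j. e j \<bullet> x - e j \<bullet> v = 0)"
    proof -
      have "(\<forall>h\<in>H. fst h \<bullet> x + snd h \<le> 0) \<longleftrightarrow> f x \<le> 1 \<and> 0 \<le> f x \<and>
          (\<forall>j. e j \<bullet> x - e j \<bullet> v \<le> 0) \<and> (\<forall>j. e j \<bullet> v - e j \<bullet> x \<le> 0)"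
        unfolding H_def f by (auto simp: ball_Un algebra_simps)
      then show ?thesis by (auto simp: order_antisym_conv)
    qed
    also have "\<dots> \<longleftrightarrow> f x \<in> {0..1} \<and> x = v + f x *\<^sub>R w"
      unfolding e by (auto simp: vec_eq_iff)
    also have "\<dots> \<longleftrightarrow> (\<exists>t\<in>{0..1}. x = v + t *\<^sub>R w)"
    proof -
      have "f (v + t *\<^sub>R w) = t" for t using k by (simp add: f_def)
      then show ?thesis by (metis (no_types))
    qed
    finally show ?thesis .
  qed
  then show ?thesis using \<phi> by blast
qed

text \<open>Hypotheses may hold on initial segments of different lengths, and Modus Ponens passes to
  the shorter of two. Axioms hold wherever the ray stays in the cube.\<close>

lemma derivable_sound_along:
  fixes v u :: "real ^ 'n::finite"
  assumes "T \<turnstile> \<phi>" "\<delta> > 0" "\<And>s. 0 \<le> s \<Longrightarrow> s \<le> \<delta> \<Longrightarrow> v + s *\<^sub>R u \<in> unit_cube"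
    and "\<And>\<theta>. \<theta> \<in> T \<Longrightarrow> \<exists>\<epsilon>>0. \<forall>s. 0 \<le> s \<and> s \<le> \<epsilon> \<longrightarrow> tval \<theta> (v + s *\<^sub>R u) = 1"
  shows "\<exists>\<epsilon>>0. \<forall>s. 0 \<le> s \<and> s \<le> \<epsilon> \<longrightarrow> tval \<phi> (v + s *\<^sub>R u) = 1"
proof -
  have taut: "\<exists>\<epsilon>>0. \<forall>s. 0 \<le> s \<and> s \<le> \<epsilon> \<longrightarrow> tval \<phi> (v + s *\<^sub>R u) = 1"
    if "{} \<turnstile> \<phi>" for \<phi>
    using assms(2,3) derivable_sound[OF that] by blast
  show ?thesis using assms(1)
  proof (induction rule: derivable.induct)
    case (MP \<phi> \<psi>)
    then obtain e1 e2 where e1: "e1 > 0" "\<And>s. 0 \<le> s \<Longrightarrow> s \<le> e1 \<Longrightarrow> tval \<phi> (v + s *\<^sub>R u) = 1"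
      and e2: "e2 > 0" "\<And>s. 0 \<le> s \<Longrightarrow> s \<le> e2 \<Longrightarrow> tval (Imp \<phi> \<psi>) (v + s *\<^sub>R u) = 1"
      by blast
    have "tval \<psi> (v + s *\<^sub>R u) = 1" if "0 \<le> s" "s \<le> min \<delta> (min e1 e2)" for s
    proof (rule derivable_sound)
      show "{\<phi>, Imp \<phi> \<psi>} \<turnstile> \<psi>" by (rule derivable.MP[of _ \<phi>]) (auto intro: derivable.hyp)
    qed (use that assms(3)[of s] e1(2)[of s] e2(2)[of s] in \<open>auto simp del: tval.simps\<close>)
    then show ?case using e1(1) e2(1) assms(2) by (intro exI[of _ "min \<delta> (min e1 e2)"]) auto
  qed (rule assms(4) taut; (assumption | rule derivable.A1 derivable.A2 derivable.A3 derivable.A4))+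
qed

section \<open>Construction of the two formulas and the final argument\<close>

theorem theorem5p5:
  fixes \<Theta> :: "('n::finite) form set" and u v :: "real ^ 'n"
  assumes "semisimple (LIND \<Theta>)"
    and "v \<in> Mod \<Theta>" and "rational_point v"
    and "BS_tangent (Mod \<Theta>) v u" and "outgoing (Mod \<Theta>) v u" and "rational_vector u"
  shows "\<not> strongly_semisimple (LIND \<Theta>) \<and>
    (\<exists>\<gamma> lam.
       \<Theta> \<union> {\<gamma>} \<Turnstile> lam \<and> \<not> \<Theta> \<union> {\<gamma>} \<Turnstile>\<^sub>\<partial> lam \<and>
       (\<forall>\<psi>. \<Theta> \<union> {\<gamma>} \<Turnstile>\<^sub>\<partial> \<psi> \<longrightarrow> tval \<psi> v = 1 \<and> has_dir_deriv (tval \<psi>) v u 0) \<and>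
       tval lam v = 1 \<and> (\<exists>D<0. has_dir_deriv (tval lam) v u D))"
proof -
  \<comment> \<open>This will turn out to be satisfaction of \<open>\<psi>\<close> by the
    differential valuation \<open>[v, u]\<close>.\<close>
  let ?germ = "\<lambda>\<psi>. \<exists>\<epsilon>>0. \<forall>s. 0 \<le> s \<and> s \<le> \<epsilon> \<longrightarrow> tval \<psi> (v + s *\<^sub>R u) = 1"
  have u: "norm u = 1" using assms(4) by (simp add: BS_tangent_def)
  have "Mod \<Theta> \<subseteq> unit_cube" by (auto simp: Mod_def)
  then obtain \<delta> where \<delta>: "\<delta> > 0" "\<And>s. 0 \<le> s \<Longrightarrow> s \<le> \<delta> \<Longrightarrow> v + s *\<^sub>R u \<in> unit_cube"
    using tangent_in_cube[OF assms(4)] by blast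
  obtain \<mu> where \<mu>: "\<mu> > 0" "\<And>s. 0 < s \<Longrightarrow> s < \<mu> \<Longrightarrow> v + s *\<^sub>R u \<notin> Mod \<Theta>"
  proof -
    obtain \<mu> where \<mu>: "\<mu> > 0" "rel_interior (closed_segment v (v + \<mu> *\<^sub>R u)) \<inter> Mod \<Theta> = {}"
      using assms(5) unfolding outgoing_def segment_convex_hull by blast
    have "v + s *\<^sub>R u \<in> rel_interior (closed_segment v (v + \<mu> *\<^sub>R u))" if "0 < s" "s < \<mu>" for s
    proof -
      have "v \<noteq> v + \<mu> *\<^sub>R u" using \<mu>(1) u by auto
      moreover from this have "v + s *\<^sub>R u \<in> open_segment v (v + \<mu> *\<^sub>R u)"
        unfolding in_segment using that
        by (intro conjI exI[of _ "s / \<mu>"]) (auto simp: algebra_simps)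
      ultimately show ?thesis by (simp add: rel_interior_closed_segment)
    qed
    then show ?thesis using \<mu> by (intro that[of \<mu>]) auto
  qed
  obtain \<epsilon> where \<epsilon>: "\<epsilon> > 0" "\<epsilon> < \<delta>" "\<epsilon> < \<mu>" "rational_point (\<epsilon> *\<^sub>R u)"
  proof -
    \<comment> \<open>Rational multiples of \<open>c *\<^sub>R u\<close> are rational. The factor
      \<open>\<bar>c\<bar> / M\<close> is \<open>c\<close> times the rational number
      \<open>sgn c / M\<close>, and a large \<open>M\<close> brings it below
      \<open>m\<close>.\<close>
    obtain c where c: "c \<noteq> 0" "rational_point (c *\<^sub>R u)"
      using assms(6) by (auto simp: rational_vector_def)
    define m where "m = min \<delta> \<mu>"
    have m: "0 < m" using \<delta>(1) \<mu>(1) by (simp add: m_def)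
    obtain M where M: "\<bar>c\<bar> / m < real M" using reals_Archimedean2 by blast
    moreover have "0 < \<bar>c\<bar> / m" using c(1) m by simp
    ultimately have M0: "0 < real M" by linarith
    then have "\<bar>c\<bar> / real M < m" using M m by (simp add: field_simps)
    moreover have "rational_point ((\<bar>c\<bar> / real M) *\<^sub>R u)"
    proof -
      have "(\<bar>c\<bar> / real M) * u $ i \<in> \<rat>" for i
      proof -
        have "(\<bar>c\<bar> / real M) * u $ i = (sgn c / real M) * (c * u $ i)"
          by (simp add: abs_sgn ac_simps)
        moreover have "sgn c / real M \<in> \<rat>" by (simp add: sgn_if)
        ultimately show ?thesis
          using c(2) Rats_mult unfolding rational_point_def vector_scaleR_component real_scaleR_def by metis
      qed
      then show ?thesis by (simp add: rational_point_def)
    qed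
    ultimately show ?thesis using c(1) M0 by (intro that[of "\<bar>c\<bar> / real M"]) (auto simp: m_def)
  qed
  have "\<epsilon> *\<^sub>R u \<noteq> 0" using \<epsilon>(1) u by auto
  then obtain \<gamma> where \<gamma>: "\<And>x. x \<in> unit_cube \<Longrightarrow>
      tval \<gamma> x = 1 \<longleftrightarrow> (\<exists>t\<in>{0..1}. x = v + t *\<^sub>R \<epsilon> *\<^sub>R u)"
    using rational_segment_representable[OF assms(3) \<epsilon>(4)] by blast
  \<comment> \<open>\<open>lam\<close> has to decrease along \<open>u\<close>, so a coordinate in
    which \<open>u\<close> moves is taken with its sign; \<open>?a \<bullet> x\<close> then grows
    along \<open>u\<close>.\<close>
  obtain k where k: "u $ k \<noteq> 0" using u by (metis norm_zero vec_eq_iff zero_index zero_neq_one)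
  let ?a = "axis k (sgn (u $ k))"
  have inner_a: "?a \<bullet> x = sgn (u $ k) * x $ k" for x by (simp add: inner_axis')
  have "rational_point ?a" by (simp add: rational_point_def axis_def sgn_if)
  moreover have "?a \<bullet> v \<in> \<rat>"
    using assms(3) unfolding inner_a by (simp add: rational_point_def sgn_if)
  ultimately obtain lam and d :: real where "d > 0"
    and lam: "\<And>x. x \<in> unit_cube \<Longrightarrow> tval lam x = 1 - max 0 (min 1 (d * (?a \<bullet> x + - (?a \<bullet> v))))"
    using rational_affine_representable[of ?a "- (?a \<bullet> v)"] by auto
  define D where "D = d * \<bar>u $ k\<bar>"
  have D: "D > 0" using \<open>d > 0\<close> k by (simp add: D_def)
  \<comment> \<open>Up to \<open>s = 1 / D\<close> the clamp does not saturate, so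
    \<open>lam\<close> falls linearly with slope \<open>- D\<close>.\<close>
  have lam_along: "tval lam (v + s *\<^sub>R u) = 1 + s * (- D)" if "0 \<le> s" "s \<le> min \<delta> (1 / D)" for s
  proof -
    have "?a \<bullet> (s *\<^sub>R u) = s * \<bar>u $ k\<bar>"
      unfolding inner_a by (simp add: abs_sgn ac_simps)
    then have "d * (?a \<bullet> (v + s *\<^sub>R u) + - (?a \<bullet> v)) = s * D"
      by (simp add: inner_add_right D_def)
    moreover have "s * D \<le> 1" "0 \<le> s * D" using that D by (auto simp: field_simps)
    ultimately show ?thesis using lam[OF \<delta>(2), of s] that by simp
  qed
  have "min \<delta> (1 / D) > 0" using \<delta>(1) D by simp
  then have lam_deriv: "has_dir_deriv (tval lam) v u (- D)"
    using lam_along by (rule has_dir_deriv_local)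
  have lam_v: "tval lam v = 1" using lam_along[of 0] \<open>min \<delta> (1 / D) > 0\<close> by simp
  have germ_deriv: "has_dir_deriv (tval \<psi>) v u 0" and germ_v: "tval \<psi> v = 1" if germ: "?germ \<psi>" for \<psi>
  proof -
    obtain e where e: "e > 0" "\<And>s. 0 \<le> s \<Longrightarrow> s \<le> e \<Longrightarrow> tval \<psi> (v + s *\<^sub>R u) = 1"
      using germ by blast
    show "has_dir_deriv (tval \<psi>) v u 0"
      using e by (intro has_dir_deriv_local[where a = 1]) auto
    show "tval \<psi> v = 1" using e(1) e(2)[of 0] by simp
  qed
  have not_germ_lam: "\<not> ?germ lam"
  proof
    assume "?germ lam"
    then have "- D = 0" by (rule has_dir_deriv_unique[OF lam_deriv germ_deriv])
    then show False using D by simp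
  qed
  have germ_\<gamma>: "?germ \<gamma>"
  proof (intro exI[of _ \<epsilon>] conjI allI impI)
    fix s assume s: "0 \<le> s \<and> s \<le> \<epsilon>"
    then have "v + s *\<^sub>R u = v + (s / \<epsilon>) *\<^sub>R \<epsilon> *\<^sub>R u" "s / \<epsilon> \<in> {0..1}" using \<epsilon>(1) by auto
    moreover have "v + s *\<^sub>R u \<in> unit_cube" using \<delta>(2) s \<epsilon>(2) by simp
    ultimately show "tval \<gamma> (v + s *\<^sub>R u) = 1" using \<gamma> by blast
  qed (rule \<epsilon>(1))
  have germ_\<Theta>: "?germ \<theta>" if "\<theta> \<in> \<Theta>" for \<theta>
    using that by (intro tval_eq_1_along_tangent[OF assms(4)]) (simp add: Mod_def)
  have germ_T: "?germ \<theta>" if "\<theta> \<in> insert \<gamma> \<Theta>" for \<theta>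
    using that by (rule insertE) (simp only: germ_\<gamma>, rule germ_\<Theta>)
  \<comment> \<open>\<open>\<gamma>\<close> puts \<open>x\<close> on the segment of length
    \<open>\<epsilon> < \<mu>\<close>, whose part beyond \<open>v\<close> misses
    \<open>Mod \<Theta>\<close> because \<open>u\<close> is outgoing.\<close>
  have "x = v" if x: "x \<in> Mod (insert \<gamma> \<Theta>)" for x
  proof -
    have "x \<in> unit_cube" "tval \<gamma> x = 1" and x\<Theta>: "x \<in> Mod \<Theta>" using x by (auto simp: Mod_def)
    then obtain t where t: "0 \<le> t" "t \<le> 1" "x = v + (t * \<epsilon>) *\<^sub>R u" using \<gamma> by auto
    have "t * \<epsilon> < \<mu>" using t(1,2) \<epsilon>(1,3) by (meson le_less_trans mult_left_le_one_le less_imp_le)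
    then have "\<not> 0 < t * \<epsilon>" using \<mu>(2) x\<Theta> t(3) by blast
    then show "x = v" using t(1,3) \<epsilon>(1) by (simp add: zero_less_mult_iff)
  qed
  then have entails: "insert \<gamma> \<Theta> \<Turnstile> lam" using lam_v by (auto simp: entails_def)
  \<comment> \<open>All members of \<open>insert \<gamma> \<Theta>\<close> are 1 on an initial
    segment along \<open>u\<close>, a property that derivations preserve and \<open>lam\<close>
    lacks.\<close>
  have "\<not> insert \<gamma> \<Theta> \<turnstile> lam"
  proof
    assume "insert \<gamma> \<Theta> \<turnstile> lam"
    then have "?germ lam"
      by (rule derivable_sound_along[OF _ \<delta> germ_T])
    then show False using not_germ_lam by blast
  qed
  then have not_strong: "\<not> strongly_semisimple (LIND \<Theta>)" by (rule not_strongly_semisimple_LIND[OF entails])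
  have sat_iff: "diff_sat [v, u] \<psi> \<longleftrightarrow> ?germ \<psi>" for \<psi>
    using \<delta> by (rule diff_sat_pair_iff)
  have val: "diff_valuation [v, u]"
    using u \<delta> by (rule diff_valuation_pair)
  have germ: "?germ \<psi>" if "insert \<gamma> \<Theta> \<Turnstile>\<^sub>\<partial> \<psi>" for \<psi>
  proof -
    have "\<forall>\<theta>\<in>insert \<gamma> \<Theta>. diff_sat [v, u] \<theta>"
      unfolding sat_iff by (rule ballI) (rule germ_T)
    then have "diff_sat [v, u] \<psi>" using that val by (simp only: diff_entails_def)
    then show ?thesis by (simp only: sat_iff)
  qed
  show ?thesis
    unfolding Un_insert_right sup_bot.right_neutral
  proof (rule conjI[OF not_strong], rule exI[of _ \<gamma>], rule exI[of _ lam],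
      intro conjI allI impI entails lam_v)
    show "\<not> insert \<gamma> \<Theta> \<Turnstile>\<^sub>\<partial> lam" using germ not_germ_lam by blast
    show "tval \<psi> v = 1" "has_dir_deriv (tval \<psi>) v u 0" if "insert \<gamma> \<Theta> \<Turnstile>\<^sub>\<partial> \<psi>" for \<psi>
      using germ_v[OF germ[OF that]] germ_deriv[OF germ[OF that]] .
    show "\<exists>D<0. has_dir_deriv (tval lam) v u D"
      using lam_deriv D by (intro exI[of _ "- D"]) simp
  qed
qed

end
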